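(* Let $d\ge 3$ be a fixed integer. Let $(G_N)$ be an infinite family of finite connected $d$-regular graphs, $G_N$ having $N$ vertices, whose girth tends to infinity as $N\to\infty$. Then the family of $2$-dimensional cell complexes $G_N\times G_N$ is not $1$-hyperfinite.
   Context: A graph is regarded as a $1$-dimensional cell complex with the path metric in which every edge has length $1$. The product $G\times G$ is the square complex whose $0$-cells are pairs of vertices, whose $1$-cells are (edge, vertex) or (vertex, edge) pairs, and whose $2$-cells are the squares edge $\times$ edge; it carries the product metric $\sqrt{d_1^2+d_2^2}$, where $d_i$ is the path metric of the $i$-th factor. (Replacing the metrics by uniformly quasi-isometric ones does not affect the notions below.) Localizable: a metrized cell complex $Y$ is "$m$-localizable with range $R$" if there is a continuous map $f:Y\to K$ to some simplicial $m$-complex $K$ such that for every point $q\in K$ the pre-image $f^{-1}(q)$ has diameter less than $R$. Hyperfinite: a family of metrized cell complexes $K(N)$ (with number of $0$-cells tending to infinity) is "$m$-hyperfinite" if for every $\epsilon>0$ there exists $R$ such that for every complex in the family one can remove at most a fraction $\epsilon$ of its $0$-cells, removing also all higher-dimensional cells attached to (i.e. having in their closure) a removed $0$-cell, so that the resulting complex (with diameters measured in the metric of the original complex) is $m$-localizable with range $R$. A family is "not $m$-hyperfinite" if this fails. *)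

theory Defs
  imports "HOL-Analysis.Analysis" "Graph_Theory.Digraph_Component"
begin

section \<open>Metrized cell complexes\<close>

text \<open>
  \<open>cells X k\<close> is the set of open \<open>k\<close>-cells, each given as a subset of the underlying
  space; in particular a \<open>0\<close>-cell is a singleton.  The topology is the one induced by the
  metric, which for the finite complexes considered here is the cell complex topology.
\<close>

record 'p metrized_complex =
  points :: "'p set"
  pdist :: "'p \<Rightarrow> 'p \<Rightarrow> real"
  cells :: "nat \<Rightarrow> 'p set set"

definition complex_topology :: "'p metrized_complex \<Rightarrow> 'p topology" where
  "complex_topology X = Metric_space.mtopology (points X) (pdist X)"

definition diameter_in :: "'p metrized_complex \<Rightarrow> 'p set \<Rightarrow> ennreal" where
  "diameter_in X A = (SUP (x, y) \<in> A \<times> A. ennreal (pdist X x y))"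

text \<open>The product of open cells is an open cell, its dimension being the sum.\<close>

definition product_complex ::
  "'p metrized_complex \<Rightarrow> 'q metrized_complex \<Rightarrow> ('p \<times> 'q) metrized_complex" where
  "product_complex X Y =
    \<lparr> points = points X \<times> points Y,
      pdist = prod_dist (pdist X) (pdist Y),
      cells = (\<lambda>k. {a \<times> b | a b i j. a \<in> cells X i \<and> b \<in> cells Y j \<and> i + j = k}) \<rparr>"

text \<open>
  Removal of a set \<open>S\<close> of \<open>0\<close>-cells and of all cells having a member of \<open>S\<close> in their
  closure.  Distances are still those of \<open>X\<close>.
\<close>

definition surviving_cells :: "'p metrized_complex \<Rightarrow> 'p set set \<Rightarrow> nat \<Rightarrow> 'p set set" where
  "surviving_cells X S k =
    {c \<in> cells X k. \<forall>z\<in>S. \<not> z \<subseteq> complex_topology X closure_of c}"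

definition remove_0_cells :: "'p metrized_complex \<Rightarrow> 'p set set \<Rightarrow> 'p metrized_complex" where
  "remove_0_cells X S =
    \<lparr> points = (\<Union>k. \<Union>(surviving_cells X S k)),
      pdist = pdist X,
      cells = surviving_cells X S \<rparr>"


section \<open>Simplicial complexes and their geometric realization\<close>

definition simplicial_complex_dim_le :: "nat \<Rightarrow> 'k set set \<Rightarrow> bool" where
  "simplicial_complex_dim_le m K \<longleftrightarrow>
    (\<forall>\<sigma>\<in>K. finite \<sigma> \<and> \<sigma> \<noteq> {} \<and> card \<sigma> \<le> m + 1) \<and>
    (\<forall>\<sigma>\<in>K. \<forall>\<tau>. \<tau> \<subseteq> \<sigma> \<and> \<tau> \<noteq> {} \<longrightarrow> \<tau> \<in> K)"

text \<open>Points are given by their barycentric coordinates.\<close>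

definition closed_simplex :: "'k set \<Rightarrow> ('k \<Rightarrow> real) set" where
  "closed_simplex \<sigma> =
    {x. (\<forall>v. 0 \<le> x v) \<and> (\<forall>v. v \<notin> \<sigma> \<longrightarrow> x v = 0) \<and> (\<Sum>v\<in>\<sigma>. x v) = 1}"

definition polyhedron_of :: "'k set set \<Rightarrow> ('k \<Rightarrow> real) set" where
  "polyhedron_of K = (\<Union>\<sigma>\<in>K. closed_simplex \<sigma>)"

text \<open>
  The weak topology with respect to the closed simplices, each of which carries its Euclidean
  topology (as a subspace of the product space).
\<close>

definition polyhedron_topology :: "'k set set \<Rightarrow> ('k \<Rightarrow> real) topology" where
  "polyhedron_topology K = topology (\<lambda>U. U \<subseteq> polyhedron_of K \<and>
    (\<forall>\<sigma>\<in>K. openin (top_of_set (closed_simplex \<sigma>)) (U \<inter> closed_simplex \<sigma>)))"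

lemma openin_polyhedron_topology:
  "openin (polyhedron_topology K) U \<longleftrightarrow> U \<subseteq> polyhedron_of K \<and>
    (\<forall>\<sigma>\<in>K. openin (top_of_set (closed_simplex \<sigma>)) (U \<inter> closed_simplex \<sigma>))"
proof -
  have "istopology (\<lambda>U. U \<subseteq> polyhedron_of K \<and>
    (\<forall>\<sigma>\<in>K. openin (top_of_set (closed_simplex \<sigma>)) (U \<inter> closed_simplex \<sigma>)))"
    unfolding istopology_def
  proof (intro conjI allI impI ballI)
    fix U V \<sigma>
    assume "U \<subseteq> polyhedron_of K \<and>
        (\<forall>\<sigma>\<in>K. openin (top_of_set (closed_simplex \<sigma>)) (U \<inter> closed_simplex \<sigma>))"
      and "V \<subseteq> polyhedron_of K \<and>
        (\<forall>\<sigma>\<in>K. openin (top_of_set (closed_simplex \<sigma>)) (V \<inter> closed_simplex \<sigma>))"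
      and "\<sigma> \<in> K"
    then have "openin (top_of_set (closed_simplex \<sigma>)) (U \<inter> closed_simplex \<sigma>)"
      and "openin (top_of_set (closed_simplex \<sigma>)) (V \<inter> closed_simplex \<sigma>)"
      by blast+
    then have "openin (top_of_set (closed_simplex \<sigma>))
        ((U \<inter> closed_simplex \<sigma>) \<inter> (V \<inter> closed_simplex \<sigma>))"
      by (rule openin_Int)
    then show "openin (top_of_set (closed_simplex \<sigma>)) (U \<inter> V \<inter> closed_simplex \<sigma>)"
      by (simp only: Int_ac Int_absorb Int_left_absorb)
  next
    fix \<U> \<sigma>
    assume *: "\<forall>U\<in>\<U>. U \<subseteq> polyhedron_of K \<and>
        (\<forall>\<sigma>\<in>K. openin (top_of_set (closed_simplex \<sigma>)) (U \<inter> closed_simplex \<sigma>))"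
      and "\<sigma> \<in> K"
    then have "openin (top_of_set (closed_simplex \<sigma>)) (\<Union>U\<in>\<U>. U \<inter> closed_simplex \<sigma>)"
      by (intro openin_Union) blast
    then show "openin (top_of_set (closed_simplex \<sigma>)) (\<Union>\<U> \<inter> closed_simplex \<sigma>)"
      by (simp only: Int_Union2)
  qed blast+
  then show ?thesis
    unfolding polyhedron_topology_def by (simp add: topology_inverse')
qed

lemma topspace_polyhedron_topology [simp]:
  "topspace (polyhedron_topology K) = polyhedron_of K"
proof -
  have "openin (polyhedron_topology K) (polyhedron_of K)"
    unfolding openin_polyhedron_topology
  proof (intro conjI ballI)
    fix \<sigma> assume "\<sigma> \<in> K"
    then have "polyhedron_of K \<inter> closed_simplex \<sigma> = closed_simplex \<sigma>"
      by (auto simp: polyhedron_of_def)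
    then show "openin (top_of_set (closed_simplex \<sigma>)) (polyhedron_of K \<inter> closed_simplex \<sigma>)"
      by simp
  qed simp
  then show ?thesis
    by (meson openin_polyhedron_topology openin_subset openin_topspace subset_antisym)
qed


section \<open>Localizability and hyperfiniteness\<close>

text \<open>
  HOL cannot quantify existentially over the type \<open>'k\<close> of the vertices of the target complex,
  so that type is a parameter.  A negative statement left polymorphic in \<open>'k\<close> excludes target
  complexes on vertex sets of every cardinality.
\<close>

definition localizable ::
  "'k itself \<Rightarrow> nat \<Rightarrow> real \<Rightarrow> 'p metrized_complex \<Rightarrow> bool" where
  "localizable T m R Y \<longleftrightarrow>
    (\<exists>(K :: 'k set set) f.
      simplicial_complex_dim_le m K \<and>
      continuous_map (complex_topology Y) (polyhedron_topology K) f \<and>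
      (\<forall>q \<in> polyhedron_of K. diameter_in Y {y \<in> points Y. f y = q} < ennreal R))"

definition hyperfinite ::
  "'k itself \<Rightarrow> nat \<Rightarrow> 'i set \<Rightarrow> ('i \<Rightarrow> 'p metrized_complex) \<Rightarrow> bool" where
  "hyperfinite T m I X \<longleftrightarrow>
    (\<forall>\<epsilon>>0. \<exists>R. \<forall>i\<in>I. \<exists>S. finite S \<and> S \<subseteq> cells (X i) 0 \<and>
      real (card S) \<le> \<epsilon> * real (card (cells (X i) 0)) \<and>
      localizable T m R (remove_0_cells (X i) S))"


section \<open>Graphs\<close>

text \<open>
  A graph (as a \<open>1\<close>-dimensional complex: loops and multiple edges are allowed) is given by a
  \<open>pre_digraph\<close>, whose arcs are the edges of the graph, each listed once and with an
  arbitrary orientation that only serves to parametrize the edge.  Hence degrees count both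
  incoming and outgoing arcs (a loop counts twice), and cycles ignore the orientation.
\<close>

definition regular_graph :: "nat \<Rightarrow> ('v, 'e) pre_digraph \<Rightarrow> bool" where
  "regular_graph d G \<longleftrightarrow> (\<forall>v \<in> verts G. in_degree G v + out_degree G v = d)"

text \<open>Loops are cycles of length \<open>1\<close>, pairs of parallel edges are cycles of length \<open>2\<close>.\<close>

definition undirected_cycle :: "('v, 'e) pre_digraph \<Rightarrow> 'v list \<Rightarrow> 'e list \<Rightarrow> bool" where
  "undirected_cycle G vs es \<longleftrightarrow>
    es \<noteq> [] \<and> length vs = length es \<and> distinct vs \<and> distinct es \<and> set es \<subseteq> arcs G \<and>
    (\<forall>i < length es.
      {tail G (es ! i), head G (es ! i)} = {vs ! i, vs ! (Suc i mod length es)})"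

definition girth :: "('v, 'e) pre_digraph \<Rightarrow> enat" where
  "girth G = Inf {enat (length es) | vs es. undirected_cycle G vs es}"

datatype ('v, 'e) graph_point = Vertex 'v | Inner 'e real

definition edge_map :: "('v, 'e) pre_digraph \<Rightarrow> 'e \<Rightarrow> real \<Rightarrow> ('v, 'e) graph_point" where
  "edge_map G e t =
    (if t = 0 then Vertex (tail G e) else if t = 1 then Vertex (head G e) else Inner e t)"

definition graph_points :: "('v, 'e) pre_digraph \<Rightarrow> ('v, 'e) graph_point set" where
  "graph_points G = Vertex ` verts G \<union> (\<Union>e \<in> arcs G. edge_map G e ` {0..1})"

text \<open>
  \<open>pl_path G x l y\<close>: there is a piecewise linear path of length \<open>l\<close> from \<open>x\<close> to \<open>y\<close>, where
  every edge has length \<open>1\<close>.  The path metric is the infimum of the lengths of such paths.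
\<close>

inductive pl_path ::
  "('v, 'e) pre_digraph \<Rightarrow> ('v, 'e) graph_point \<Rightarrow> real \<Rightarrow> ('v, 'e) graph_point \<Rightarrow> bool"
  for G where
  trivial: "x \<in> graph_points G \<Longrightarrow> pl_path G x 0 x"
| segment: "pl_path G x l (edge_map G e s) \<Longrightarrow> e \<in> arcs G \<Longrightarrow> s \<in> {0..1} \<Longrightarrow> t \<in> {0..1}
    \<Longrightarrow> pl_path G x (l + \<bar>s - t\<bar>) (edge_map G e t)"

definition path_metric ::
  "('v, 'e) pre_digraph \<Rightarrow> ('v, 'e) graph_point \<Rightarrow> ('v, 'e) graph_point \<Rightarrow> real" where
  "path_metric G x y = Inf {l. pl_path G x l y}"

definition graph_complex :: "('v, 'e) pre_digraph \<Rightarrow> ('v, 'e) graph_point metrized_complex" where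
  "graph_complex G =
    \<lparr> points = graph_points G,
      pdist = path_metric G,
      cells = (\<lambda>k. if k = 0 then (\<lambda>v. {Vertex v}) ` verts G
                   else if k = 1 then (\<lambda>e. edge_map G e ` {0<..<1}) ` arcs G
                   else {}) \<rparr>"

end

(*
  A map with small fibres from what remains of G x G to a graph K pulls back a fine subdivision of K
  to a cover of the remainder by small sets whose nerve is one-dimensional.
  The first homology of a d-regular graph has rank at least (d/2 - 1)N, so products of cycles span a
  space of 2-cycles mod 2 of G x G of dimension at least (d/2 - 1)^2 N^2; avoiding the squares at the
  removed vertices costs at most d^2 conditions for each of them, so a 2-cycle z survives that is nonzero
  on some square e0 x e0'.  On the other hand z(e0, e0') is the evaluation at z of the cup product
  of the cochains dual to e0 and e0'.  Large girth makes small pieces of each factor tree-like, so that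
  these cocycles are coboundaries near every set of the cover: both classes come from the nerve, which has
  no second cohomology, and hence z(e0, e0') = 0.
*)

theory Submission
  imports Defs "HOL-Library.Z2"
begin

section \<open>Chains modulo 2\<close>

text \<open>The cohomology of the nerve is never formed. The cover is made subordinate to a grid in
  every surviving square, so that \<open>z\<close>, subdivided, splits into labelled parts, and two
  parts meet along a 1-chain, their interface. Summation by parts with local potentials
  \<open>h\<close> of the first cocycle turns z(e0, e0') into a sum over pairs of labels of opposite
  type: a constant \<open>c i j\<close> times the value of the second cocycle on the interface of
  \<open>i\<close> and \<open>j\<close>. With two types at most two parts meet at a corner, so every
  interface is closed; it lies near one label, where the second cocycle is a coboundary, and the
  value is 0. Only \<open>h\<close> has to be compared between neighbouring labels; this makes the
  radius on which potentials must exist about four times the size of a piece. Diameters refer to the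
  original complex, so a set of the cover may fall apart inside the remainder. The potentials
  therefore live on balls of the whole graph and not on the pieces. The target K may be infinite;
  compactness is applied to finitely many closed squares and one barycentric coordinate at a
  time.\<close>

definition incidence :: "('e \<Rightarrow> 'v) \<Rightarrow> ('e \<Rightarrow> 'v) \<Rightarrow> 'v \<Rightarrow> 'e \<Rightarrow> bit" where
  "incidence a b x e = of_bool (a e = x) + of_bool (b e = x)"

text \<open>These rules would turn the field operations into bit operations.\<close>

declare add_bit_eq_xor [simp del] mult_bit_eq_and [simp del]

lemma bit_add_self_left: "x + (x + y) = (y::bit)"
  by (cases x) (simp_all flip: add.assoc)

lemma bit_add_eq_0_iff: "x + y = 0 \<longleftrightarrow> x = (y::bit)"
  by (cases x; cases y) simp_all

lemma bit_eqI_nonzero: "(x \<noteq> 0 \<longleftrightarrow> y \<noteq> 0) \<Longrightarrow> x = (y::bit)"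
  by (cases x; cases y) simp_all

lemma bit_mult_self: "x * x = (x::bit)"
  by (cases x) simp_all

lemma incidence_nonzeroD: "incidence a b x e \<noteq> 0 \<Longrightarrow> x = a e \<or> x = b e"
  by (auto simp: incidence_def)

text \<open>The right-hand side is the coboundary of \<open>h\<close> on \<open>e\<close>. Loops are
  covered because \<open>incidence\<close> counts both ends, and the two terms cancel modulo
  2.\<close>

lemma sum_incidence:
  assumes "finite V" "a e \<in> V" "b e \<in> V"
  shows "(\<Sum>x\<in>V. h x * incidence a b x e) = h (a e) + h (b e)"
proof -
  have "(\<Sum>x\<in>V. h x * incidence a b x e) =
      (\<Sum>x\<in>V. if a e = x then h x else 0) + (\<Sum>x\<in>V. if b e = x then h x else 0)"
    unfolding sum.distrib[symmetric] by (rule sum.cong) (auto simp: incidence_def distrib_left)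
  also have "\<dots> = h (a e) + h (b e)"
    using assms by simp
  finally show ?thesis .
qed

lemma sum_eq_single:
  assumes "finite A" "i \<in> A" "\<And>j. j \<in> A \<Longrightarrow> j \<noteq> i \<Longrightarrow> f j = 0"
  shows "sum f A = f i"
  by (subst sum.remove[OF assms(1,2)]) (simp add: assms(3) sum.neutral)

lemma sum_bit_nonzeroD:
  fixes f :: "'i \<Rightarrow> bit"
  assumes "sum f A \<noteq> 0"
  shows "\<exists>i\<in>A. f i \<noteq> 0"
  using assms by (metis sum.neutral)

text \<open>
  The map from labels to cut functions \<open>h\<close>, \<open>k\<close> in the locale's main result says that the cochains
  dual to the edges \<open>e0\<close>, \<open>e0'\<close> of the two factors are coboundaries near each label.  Labels are
  the vertices of a nerve that is bipartite by \<open>ty\<close>, and \<open>d1 i x e' * d1 j x e'\<close>, \<open>d2 i e y * d2 j e y\<close>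
  are the two components of the 1-cycle along which the parts of \<open>z\<close> labelled \<open>i\<close> and \<open>j\<close> meet.
\<close>

locale labelled_cycle =
  fixes V :: "'v set" and E :: "'e set" and a b :: "'e \<Rightarrow> 'v"
    and z :: "'e \<Rightarrow> 'e \<Rightarrow> bit" and lab :: "'e \<Rightarrow> 'e \<Rightarrow> 'l" and ty :: "'l \<Rightarrow> bool"
  assumes finV: "finite V" and finE: "finite E"
    and aV: "e \<in> E \<Longrightarrow> a e \<in> V" and bV: "e \<in> E \<Longrightarrow> b e \<in> V"
    and cycle1: "x \<in> V \<Longrightarrow> e' \<in> E \<Longrightarrow> (\<Sum>e\<in>E. incidence a b x e * z e e') = 0"
    and cycle2: "e \<in> E \<Longrightarrow> y \<in> V \<Longrightarrow> (\<Sum>e'\<in>E. incidence a b y e' * z e e') = 0"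
    and separated: "\<lbrakk>e \<in> E; e' \<in> E; f \<in> E; f' \<in> E; z e e' \<noteq> 0; z f f' \<noteq> 0;
        x = a e \<or> x = b e; x = a f \<or> x = b f; y = a e' \<or> y = b e'; y = a f' \<or> y = b f';
        ty (lab e e') = ty (lab f f')\<rbrakk> \<Longrightarrow> lab e e' = lab f f'"
begin

definition labels :: "'l set" where "labels = (\<lambda>(e, e'). lab e e') ` (E \<times> E)"

definition zl :: "'l \<Rightarrow> 'e \<Rightarrow> 'e \<Rightarrow> bit" where
  "zl l e e' = (if lab e e' = l then z e e' else 0)"

text \<open>Boundary of the part labelled \<open>l\<close> in the direction of the first factor;
  \<open>d2\<close> is the one in the second.\<close>

definition d1 :: "'l \<Rightarrow> 'v \<Rightarrow> 'e \<Rightarrow> bit" where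
  "d1 l x e' = (\<Sum>e\<in>E. incidence a b x e * zl l e e')"

definition d2 :: "'l \<Rightarrow> 'e \<Rightarrow> 'v \<Rightarrow> bit" where
  "d2 l e y = (\<Sum>e'\<in>E. incidence a b y e' * zl l e e')"

lemma finite_labels: "finite labels"
  by (simp add: labels_def finE)

lemma labI: "e \<in> E \<Longrightarrow> e' \<in> E \<Longrightarrow> lab e e' \<in> labels"
  by (auto simp: labels_def)

lemma sum_zl: "e \<in> E \<Longrightarrow> e' \<in> E \<Longrightarrow> (\<Sum>l\<in>labels. zl l e e') = z e e'"
  using sum.delta'[OF finite_labels, of "lab e e'" "\<lambda>_. z e e'"] labI[of e e']
  by (simp add: zl_def)

lemma sum_d1: "x \<in> V \<Longrightarrow> e' \<in> E \<Longrightarrow> (\<Sum>l\<in>labels. d1 l x e') = 0"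
  unfolding d1_def
  by (subst sum.swap) (simp add: sum_distrib_left[symmetric] sum_zl cycle1)

lemma sum_d2: "e \<in> E \<Longrightarrow> y \<in> V \<Longrightarrow> (\<Sum>l\<in>labels. d2 l e y) = 0"
  unfolding d2_def
  by (subst sum.swap) (simp add: sum_distrib_left[symmetric] sum_zl cycle2)

lemma d1_nonzeroD:
  assumes "d1 l x e' \<noteq> 0"
  obtains e where "e \<in> E" "x = a e \<or> x = b e" "z e e' \<noteq> 0" "lab e e' = l"
proof -
  obtain e where "e \<in> E" "incidence a b x e * zl l e e' \<noteq> 0"
    using sum_bit_nonzeroD[OF assms[unfolded d1_def]] by blast
  then have "incidence a b x e \<noteq> 0" "zl l e e' \<noteq> 0"
    by auto
  then show ?thesis
    using that[OF \<open>e \<in> E\<close>] incidence_nonzeroD[of a b x e] by (auto simp: zl_def split: if_splits)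
qed

lemma d2_nonzeroD:
  assumes "d2 l e y \<noteq> 0"
  obtains e' where "e' \<in> E" "y = a e' \<or> y = b e'" "z e e' \<noteq> 0" "lab e e' = l"
proof -
  obtain e' where "e' \<in> E" "incidence a b y e' * zl l e e' \<noteq> 0"
    using sum_bit_nonzeroD[OF assms[unfolded d2_def]] by blast
  then have "incidence a b y e' \<noteq> 0" "zl l e e' \<noteq> 0"
    by auto
  then show ?thesis
    using that[OF \<open>e' \<in> E\<close>] incidence_nonzeroD[of a b y e'] by (auto simp: zl_def split: if_splits)
qed

lemma sum_labels_by_type:
  "(\<Sum>l\<in>labels. f l) = (\<Sum>l\<in>{l\<in>labels. ty l}. f l) + (\<Sum>l\<in>{l\<in>labels. \<not> ty l}. f l)"
proof -
  have "labels = {l\<in>labels. ty l} \<union> {l\<in>labels. \<not> ty l}" by blast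
  then show ?thesis
    using finite_labels sum.union_disjoint[of "{l\<in>labels. ty l}" "{l\<in>labels. \<not> ty l}" f] by auto
qed

lemma d1_mult_same_type:
  assumes "e' \<in> E" "ty i = ty l" "i \<noteq> l"
  shows "d1 i x e' * d1 l x e' = 0"
proof (rule ccontr)
  assume "d1 i x e' * d1 l x e' \<noteq> 0"
  then have "d1 i x e' \<noteq> 0" "d1 l x e' \<noteq> 0" by auto
  then show False
    \<comment> \<open>Both squares lie over the same \<open>e'\<close>, hence share the corner
      \<open>(x, a e')\<close>, which is what \<open>separated\<close> asks for.\<close>
    by (elim d1_nonzeroD) (use assms separated[where y = "a e'" and e' = e' and f' = e'] in metis)
qed

text \<open>The boundaries of all parts add up to zero. Multiplying this relation by
  \<open>d1 i x e'\<close> kills the other labels of the type of \<open>i\<close>, and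
  \<open>d1 i x e'\<close> is its own square.\<close>

lemma d1_split_opposite:
  assumes "x \<in> V" "e' \<in> E" "i \<in> labels" 
  shows "d1 i x e' = (\<Sum>j\<in>{j\<in>labels. ty j \<noteq> ty i}. d1 i x e' * d1 j x e')"
proof -
  have "(\<Sum>j\<in>{j\<in>labels. ty j = ty i}. d1 i x e' * d1 j x e') = d1 i x e' * d1 i x e'"
    by (rule sum_eq_single) (use finite_labels assms d1_mult_same_type in auto)
  moreover have "(\<Sum>j\<in>labels. d1 i x e' * d1 j x e') = 0"
    by (simp add: sum_distrib_left[symmetric] sum_d1 assms)
  moreover have "labels = {j\<in>labels. ty j = ty i} \<union> {j\<in>labels. ty j \<noteq> ty i}" by blast
  then have "(\<Sum>j\<in>labels. d1 i x e' * d1 j x e') =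
     (\<Sum>j\<in>{j\<in>labels. ty j = ty i}. d1 i x e' * d1 j x e')
     + (\<Sum>j\<in>{j\<in>labels. ty j \<noteq> ty i}. d1 i x e' * d1 j x e')"
    using finite_labels sum.union_disjoint[of "{j\<in>labels. ty j = ty i}" "{j\<in>labels. ty j \<noteq> ty i}"]
    by auto
  ultimately show ?thesis
    by (simp add: bit_add_eq_0_iff bit_mult_self)
qed

text \<open>Where parts \<open>i\<close> and \<open>j\<close> both reach the corner
  \<open>(x, y)\<close>, no third part does, so their boundaries agree there and each product is
  just the boundary of part \<open>i\<close>; the claim is then that a boundary has no boundary. At
  every other corner all terms vanish.\<close>

lemma interface_closed:
  assumes ij: "i \<in> labels" "j \<in> labels" "ty i" "\<not> ty j" and "x \<in> V" "y \<in> V"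
  shows "(\<Sum>e\<in>E. incidence a b x e * (d2 i e y * d2 j e y)) =
    (\<Sum>e'\<in>E. incidence a b y e' * (d1 i x e' * d1 j x e'))"
proof (cases "(\<exists>e\<in>E. \<exists>e'\<in>E. (x = a e \<or> x = b e) \<and> (y = a e' \<or> y = b e') \<and> z e e' \<noteq> 0 \<and> lab e e' = i)
   \<and> (\<exists>e\<in>E. \<exists>e'\<in>E. (x = a e \<or> x = b e) \<and> (y = a e' \<or> y = b e') \<and> z e e' \<noteq> 0 \<and> lab e e' = j)")
  case True
  \<comment> \<open>Each of the two types is already represented at the corner, by \<open>i\<close>
    and by \<open>j\<close>.\<close>
  then have only: "lab e e' = i \<or> lab e e' = j"
    if "e \<in> E" "e' \<in> E" "x = a e \<or> x = b e" "y = a e' \<or> y = b e'" "z e e' \<noteq> 0" for e e'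
    using that ij separated[where x = x and y = y] by (cases "ty (lab e e')") metis+
  have ne: "i \<noteq> j" using ij by blast
  have two: "(\<Sum>l\<in>labels. f l) = f i + f j" if "\<And>l. l \<noteq> i \<Longrightarrow> l \<noteq> j \<Longrightarrow> f l = 0" for f :: "'l \<Rightarrow> bit"
  proof -
    have "(\<Sum>l\<in>labels. f l) = (\<Sum>l\<in>{i,j}. f l)"
      by (rule sum.mono_neutral_right) (use finite_labels ij that in auto)
    then show ?thesis using ne by simp
  qed
  have L: "incidence a b x e * (d2 i e y * d2 j e y) = incidence a b x e * d2 i e y" if "e \<in> E" for e
  proof (cases "incidence a b x e = 0")
    case False
    then have "x = a e \<or> x = b e" by (rule incidence_nonzeroD)
    then have "d2 l e y = 0" if "l \<noteq> i" "l \<noteq> j" for l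
      using that only \<open>e \<in> E\<close> by (metis d2_nonzeroD)
    with two[of "\<lambda>l. d2 l e y"] sum_d2[OF that \<open>y \<in> V\<close>] show ?thesis
      by (simp add: bit_add_eq_0_iff bit_mult_self)
  qed simp
  have R: "incidence a b y e' * (d1 i x e' * d1 j x e') = incidence a b y e' * d1 i x e'"
    if "e' \<in> E" for e'
  proof (cases "incidence a b y e' = 0")
    case False
    then have "y = a e' \<or> y = b e'" by (rule incidence_nonzeroD)
    then have "d1 l x e' = 0" if "l \<noteq> i" "l \<noteq> j" for l
      using that only \<open>e' \<in> E\<close> by (metis d1_nonzeroD)
    with two[of "\<lambda>l. d1 l x e'"] sum_d1[OF \<open>x \<in> V\<close> that] show ?thesis
      by (simp add: bit_add_eq_0_iff bit_mult_self)
  qed simp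
  \<comment> \<open>Both sides are the mixed second boundary of \<open>zl i\<close>, summed in the
    two possible orders.\<close>
  have "(\<Sum>e\<in>E. incidence a b x e * d2 i e y) = (\<Sum>e'\<in>E. incidence a b y e' * d1 i x e')"
    unfolding d1_def d2_def sum_distrib_left by (subst sum.swap) (simp add: mult_ac)
  then show ?thesis by (simp only: L R cong: sum.cong)
next
  case False
  have L: "incidence a b x e * (d2 i e y * d2 j e y) = 0" if "e \<in> E" for e
  proof (rule ccontr)
    assume "incidence a b x e * (d2 i e y * d2 j e y) \<noteq> 0"
    then have "incidence a b x e \<noteq> 0" "d2 i e y \<noteq> 0" "d2 j e y \<noteq> 0" by auto
    then show False
      using False that incidence_nonzeroD[of a b x e] by (elim d2_nonzeroD) blast
  qed
  have R: "incidence a b y e' * (d1 i x e' * d1 j x e') = 0" if "e' \<in> E" for e'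
  proof (rule ccontr)
    assume "incidence a b y e' * (d1 i x e' * d1 j x e') \<noteq> 0"
    then have "incidence a b y e' \<noteq> 0" "d1 i x e' \<noteq> 0" "d1 j x e' \<noteq> 0" by auto
    then show False
      using False that incidence_nonzeroD[of a b y e'] by (elim d1_nonzeroD) blast
  qed
  show ?thesis by (simp only: L R sum.neutral_const cong: sum.cong)
qed

text \<open>The functions \<open>h l\<close> and \<open>k l\<close> are potentials of the two dual
  cocycles near the part labelled \<open>l\<close>, and \<open>c\<close> is the 1-cochain on the
  nerve formed by the jumps of \<open>h\<close>. The value of \<open>z\<close> becomes the sum of
  \<open>c i j\<close> against the pairing of the second cocycle with the interface of
  \<open>i\<close> and \<open>j\<close>, which is zero because that cocycle has the potential
  \<open>k i\<close> there.\<close>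

theorem cycle_vanishes:
  fixes h k :: "'l \<Rightarrow> 'v \<Rightarrow> bit"
  assumes e0: "e0 \<in> E" "e0' \<in> E"
    and h: "\<And>e e'. e \<in> E \<Longrightarrow> e' \<in> E \<Longrightarrow> z e e' \<noteq> 0 \<Longrightarrow>
        h (lab e e') (a e) + h (lab e e') (b e) = of_bool (e = e0)"
    and k: "\<And>e e'. e \<in> E \<Longrightarrow> e' \<in> E \<Longrightarrow> z e e' \<noteq> 0 \<Longrightarrow>
        k (lab e e') (a e') + k (lab e e') (b e') = of_bool (e' = e0')"
    and c: "\<And>e f e' x. \<lbrakk>e \<in> E; f \<in> E; e' \<in> E; z e e' \<noteq> 0; z f e' \<noteq> 0; 
        x = a e \<or> x = b e; x = a f \<or> x = b f\<rbrakk>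
        \<Longrightarrow> h (lab e e') x + h (lab f e') x = c (lab e e') (lab f e')"
  shows "z e0 e0' = 0"
proof -
  let ?A = "{l\<in>labels. ty l}" and ?B = "{l\<in>labels. \<not> ty l}"
  \<comment> \<open>Summation by parts in the first factor: the coboundary of \<open>h l\<close>
    picks out \<open>e0\<close>.\<close>
  have zl_eq: "zl l e0 e0' = (\<Sum>x\<in>V. h l x * d1 l x e0')" for l
  proof -
    have "(\<Sum>x\<in>V. h l x * d1 l x e0') = (\<Sum>e\<in>E. zl l e e0' * (\<Sum>x\<in>V. h l x * incidence a b x e))"
      unfolding d1_def sum_distrib_left by (subst sum.swap) (simp add: mult_ac)
    also have "\<dots> = (\<Sum>e\<in>E. if e0 = e then zl l e e0' else 0)"
    proof (rule sum.cong[OF refl])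
      fix e assume "e \<in> E"
      show "zl l e e0' * (\<Sum>x\<in>V. h l x * incidence a b x e) = (if e0 = e then zl l e e0' else 0)"
        by (cases "zl l e e0' = 0")
          (use h[of e e0'] e0 \<open>e \<in> E\<close> in \<open>auto simp: sum_incidence finV aV bV zl_def split: if_splits\<close>)
    qed
    also have "\<dots> = zl l e0 e0'"
      using e0 finE by simp
    finally show ?thesis ..
  qed
  \<comment> \<open>The left-hand side evaluates the cochain dual to \<open>e0'\<close> on the
    interface cycle. Replacing that cochain by the coboundary of \<open>k i\<close> moves the
    boundary onto the cycle.\<close>
  have interface: "(\<Sum>x\<in>V. d1 i x e0' * d1 j x e0') = 0" if ij: "i \<in> ?A" "j \<in> ?B" for i j
  proof -
    have "(\<Sum>x\<in>V. d1 i x e0' * d1 j x e0') =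
        (\<Sum>x\<in>V. \<Sum>e'\<in>E. if e0' = e' then d1 i x e' * d1 j x e' else 0)"
      using e0 finE by simp
    also have "\<dots> = (\<Sum>x\<in>V. \<Sum>e'\<in>E. (\<Sum>y\<in>V. k i y * incidence a b y e') * (d1 i x e' * d1 j x e'))"
    proof (intro sum.cong refl)
      fix x e' assume "x \<in> V" "e' \<in> E"
      show "(if e0' = e' then d1 i x e' * d1 j x e' else 0) =
         (\<Sum>y\<in>V. k i y * incidence a b y e') * (d1 i x e' * d1 j x e')"
      proof (cases "d1 i x e' = 0")
        case False
        then obtain e where "e \<in> E" "z e e' \<noteq> 0" "lab e e' = i"
          by (metis d1_nonzeroD)
        with k[of e e'] \<open>e' \<in> E\<close> show ?thesis
          by (auto simp: sum_incidence finV aV bV)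
      qed simp
    qed
    also have "\<dots> = (\<Sum>x\<in>V. \<Sum>y\<in>V. k i y * (\<Sum>e'\<in>E. incidence a b y e' * (d1 i x e' * d1 j x e')))"
      unfolding sum_distrib_left sum_distrib_right
      by (subst sum.swap) (simp add: mult_ac)
    also have "\<dots> = (\<Sum>x\<in>V. \<Sum>y\<in>V. k i y * (\<Sum>e\<in>E. incidence a b x e * (d2 i e y * d2 j e y)))"
      using interface_closed[of i j] ij by (intro sum.cong refl) auto
    \<comment> \<open>The potential \<open>k i\<close> depends on the second coordinate only, hence
      takes equal values at the two ends of an edge in the first direction, and these
      cancel.\<close>
    also have "\<dots> = (\<Sum>y\<in>V. k i y * (\<Sum>e\<in>E. (d2 i e y * d2 j e y) * (\<Sum>x\<in>V. 1 * incidence a b x e)))"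
      unfolding sum_distrib_left
      by (subst sum.swap, rule sum.cong[OF refl], subst sum.swap) (simp add: mult_ac)
    also have "\<dots> = 0"
      by (intro sum.neutral ballI) (simp add: sum_incidence[where h = "\<lambda>_. 1", simplified] finV aV bV)
    finally show ?thesis .
  qed
  have splitA: "d1 i x e0' = (\<Sum>j\<in>?B. d1 i x e0' * d1 j x e0')" if "i \<in> ?A" "x \<in> V" for i x
    using d1_split_opposite[of x e0' i] that e0 by simp
  have splitB: "d1 j x e0' = (\<Sum>i\<in>?A. d1 i x e0' * d1 j x e0')" if "j \<in> ?B" "x \<in> V" for j x
    using d1_split_opposite[of x e0' j] that e0 by (simp add: mult.commute)
  have "z e0 e0' = (\<Sum>l\<in>labels. zl l e0 e0')"
    using sum_zl e0 by simp
  also have "\<dots> = (\<Sum>i\<in>?A. \<Sum>x\<in>V. h i x * d1 i x e0') + (\<Sum>j\<in>?B. \<Sum>x\<in>V. h j x * d1 j x e0')"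
    unfolding zl_eq by (rule sum_labels_by_type)
  also have "(\<Sum>i\<in>?A. \<Sum>x\<in>V. h i x * d1 i x e0') =
      (\<Sum>i\<in>?A. \<Sum>x\<in>V. h i x * (\<Sum>j\<in>?B. d1 i x e0' * d1 j x e0'))"
    by (intro sum.cong refl) (use e0 splitA in auto)
  also have "\<dots> = (\<Sum>i\<in>?A. \<Sum>j\<in>?B. \<Sum>x\<in>V. h i x * (d1 i x e0' * d1 j x e0'))"
    unfolding sum_distrib_left by (rule sum.cong[OF refl]) (rule sum.swap)
  also have "(\<Sum>j\<in>?B. \<Sum>x\<in>V. h j x * d1 j x e0') =
      (\<Sum>j\<in>?B. \<Sum>x\<in>V. h j x * (\<Sum>i\<in>?A. d1 i x e0' * d1 j x e0'))"
    by (intro sum.cong refl) (use e0 splitB in auto)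
  also have "\<dots> = (\<Sum>i\<in>?A. \<Sum>j\<in>?B. \<Sum>x\<in>V. h j x * (d1 i x e0' * d1 j x e0'))"
    unfolding sum_distrib_left
    by (subst (2) sum.swap) (rule sum.cong[OF refl], rule sum.swap)
  \<comment> \<open>Each interface has been counted from both sides, so the two potentials enter
    through their sum, which is the constant \<open>c i j\<close> wherever the interface is
    nonzero.\<close>
  also have "(\<Sum>i\<in>?A. \<Sum>j\<in>?B. \<Sum>x\<in>V. h i x * (d1 i x e0' * d1 j x e0')) +
       (\<Sum>i\<in>?A. \<Sum>j\<in>?B. \<Sum>x\<in>V. h j x * (d1 i x e0' * d1 j x e0')) =
      (\<Sum>i\<in>?A. \<Sum>j\<in>?B. c i j * (\<Sum>x\<in>V. d1 i x e0' * d1 j x e0'))"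
    unfolding sum.distrib[symmetric] sum_distrib_left
  proof (intro sum.cong refl)
    fix i j x assume "i \<in> ?A" "j \<in> ?B" "x \<in> V"
    show "h i x * (d1 i x e0' * d1 j x e0') + h j x * (d1 i x e0' * d1 j x e0') =
       c i j * (d1 i x e0' * d1 j x e0')"
    proof (cases "d1 i x e0' * d1 j x e0' = 0")
      case False
      then have "d1 i x e0' \<noteq> 0" "d1 j x e0' \<noteq> 0" by auto
      then have "h i x + h j x = c i j"
        by (elim d1_nonzeroD) (use c e0 in metis)
      then show ?thesis by (simp flip: distrib_right)
    qed (simp only: mult_zero_right add_0)
  qed
  also have "\<dots> = 0"
    using interface by (intro sum.neutral ballI) simp
  finally show ?thesis .
qed

end

section \<open>Cycles and balls in a graph\<close>

definition boundary :: "('v, 'e) pre_digraph \<Rightarrow> ('e \<Rightarrow> bit) \<Rightarrow> 'v \<Rightarrow> bit" where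
  "boundary G c x = (\<Sum>e\<in>arcs G. incidence (tail G) (head G) x e * c e)"

definition support :: "('v, 'e) pre_digraph \<Rightarrow> ('e \<Rightarrow> bit) \<Rightarrow> 'e set" where
  "support G c = {e \<in> arcs G. c e \<noteq> 0}"

definition closed_chain :: "('v, 'e) pre_digraph \<Rightarrow> ('e \<Rightarrow> bit) \<Rightarrow> bool" where
  "closed_chain G c \<longleftrightarrow> (\<forall>x\<in>verts G. boundary G c x = 0)"

lemma boundary_add: "boundary G (\<lambda>e. c e + c' e) x = boundary G c x + boundary G c' x"
  by (simp add: boundary_def distrib_left sum.distrib)

lemma boundary_single:
  assumes "fin_digraph G" "e \<in> arcs G"
  shows "boundary G (\<lambda>f. of_bool (f = e)) x = of_bool (x = tail G e) + of_bool (x = head G e)"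
proof -
  have "finite (arcs G)" using assms(1) by (rule fin_digraph.finite_arcs)
  then have "boundary G (\<lambda>f. of_bool (f = e)) x = incidence (tail G) (head G) x e"
    unfolding boundary_def by (subst sum_eq_single[of _ e]) (use assms(2) in auto)
  then show ?thesis
    by (auto simp: incidence_def)
qed

lemma closed_chain_add: "closed_chain G c \<Longrightarrow> closed_chain G c' \<Longrightarrow> closed_chain G (\<lambda>e. c e + c' e)"
  by (simp add: closed_chain_def boundary_add)

lemma closed_chain_sum:
  assumes "\<And>i. i \<in> A \<Longrightarrow> closed_chain G (c i)"
  shows "closed_chain G (\<lambda>e. \<Sum>i\<in>A. f i * c i e)"
proof -
  have "boundary G (\<lambda>e. \<Sum>i\<in>A. f i * c i e) x = (\<Sum>i\<in>A. f i * boundary G (c i) x)" for x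
    unfolding boundary_def sum_distrib_left by (subst sum.swap) (simp add: mult_ac)
  then show ?thesis
    using assms by (simp add: closed_chain_def)
qed

text \<open>A non-loop contributes 1 to the boundary at its end, so another edge of the support must
  cancel it.\<close>

lemma closed_chain_second_edge:
  assumes G: "fin_digraph G" and "closed_chain G c" and e: "e \<in> support G c"
    and "tail G e \<noteq> head G e" and x: "x = tail G e \<or> x = head G e"
  obtains f where "f \<in> support G c" "f \<noteq> e" "x = tail G f \<or> x = head G f"
proof -
  interpret fin_digraph G by (rule G)
  have "x \<in> verts G" using x e by (auto simp: support_def)
  then have 0: "boundary G c x = 0"
    using assms(2) by (simp add: closed_chain_def)
  have 1: "incidence (tail G) (head G) x e * c e = 1"
    using assms(4) x e by (auto simp: incidence_def support_def)
  have "\<exists>f\<in>arcs G. f \<noteq> e \<and> incidence (tail G) (head G) x f * c f \<noteq> 0"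
  proof (rule ccontr)
    assume "\<not> ?thesis"
    then have "boundary G c x = incidence (tail G) (head G) x e * c e"
      unfolding boundary_def using e by (intro sum_eq_single) (auto simp: support_def)
    with 0 1 show False by simp
  qed
  then show ?thesis
    using that incidence_nonzeroD[of "tail G" "head G" x] by (force simp: support_def)
qed

text \<open>A longest simple path in the support cannot be prolonged, yet its last vertex has a
  second edge; that edge leads back to the path and closes a cycle inside the support. Loops are
  cycles by themselves and are treated apart.\<close>

lemma girth_le_card_support:
  assumes G: "fin_digraph G" and cl: "closed_chain G c" and ne: "support G c \<noteq> {}"
  shows "girth G \<le> enat (card (support G c))"
proof -
  interpret fin_digraph G by (rule G)
  let ?C = "support G c"
  have finC: "finite ?C" and CG: "?C \<subseteq> arcs G" by (auto simp: support_def)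
  have girthI: "girth G \<le> enat (card ?C)" if "undirected_cycle G vs es" "set es \<subseteq> ?C" for vs es
  proof -
    have "girth G \<le> enat (length es)"
      unfolding girth_def using that(1) by (intro Inf_lower) auto
    also have "length es = card (set es)"
      using that(1) by (simp add: undirected_cycle_def distinct_card)
    finally show ?thesis
      using card_mono[OF finC that(2)] order_trans enat_ord_simps(1) by blast
  qed
  show ?thesis
  proof (cases "\<exists>e\<in>?C. tail G e = head G e")
    case True
    then obtain e where "e \<in> ?C" "tail G e = head G e" by blast
    then show ?thesis
      using CG by (intro girthI[of "[tail G e]" "[e]"]) (auto simp: undirected_cycle_def)
  next
    case False
    then have noloop: "\<And>e. e \<in> ?C \<Longrightarrow> tail G e \<noteq> head G e" by blast
    \<comment> \<open>Simple paths in the support, given by vertices and edges. Distinct vertices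
      force distinct edges, which bounds the length.\<close>
    define P where "P = (\<lambda>(vs, es). es \<noteq> [] \<and> length vs = Suc (length es) \<and> distinct vs \<and> set es \<subseteq> ?C \<and>
      (\<forall>i<length es. {tail G (es ! i), head G (es ! i)} = {vs ! i, vs ! Suc i}))"
    have distinct_es: "distinct es" if "P (vs, es)" for vs es
    proof (rule ccontr)
      assume "\<not> distinct es"
      then obtain i j where "i < length es" "j < length es" "i < j" "es ! i = es ! j"
        by (metis distinct_conv_nth linorder_neqE_nat)
      moreover have "length vs = Suc (length es)" "distinct vs"
          "\<forall>i<length es. {tail G (es ! i), head G (es ! i)} = {vs ! i, vs ! Suc i}"
        using that by (auto simp: P_def)
      ultimately have "vs ! i \<in> {vs ! j, vs ! Suc j}"
        by (metis insertI1)
      moreover have "i < length vs" "j < length vs" "Suc j < length vs"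
        using \<open>i < j\<close> \<open>j < length es\<close> \<open>length vs = Suc (length es)\<close> by auto
      ultimately show False
        using \<open>distinct vs\<close> \<open>i < j\<close>
        by (auto simp: nth_eq_iff_index_eq)
    qed
    obtain e where "e \<in> ?C" using ne by blast
    then have base: "P ([tail G e, head G e], [e])"
      using noloop by (auto simp: P_def)
    have bound: "\<forall>q. P q \<longrightarrow> length (snd q) < Suc (card ?C)"
    proof (intro allI impI)
      fix q assume "P q"
      then show "length (snd q) < Suc (card ?C)"
        using distinct_es[of "fst q" "snd q"] card_mono[OF finC, of "set (snd q)"]
        by (auto simp: P_def distinct_card case_prod_unfold)
    qed
    obtain q where q: "P q" and max: "\<And>q'. P q' \<Longrightarrow> length (snd q') \<le> length (snd q)"
      using ex_has_greatest_nat[where f = "\<lambda>q. length (snd q)", OF base bound] by auto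
    obtain vs es where [simp]: "q = (vs, es)" by (cases q)
    define k where "k = length es - 1"
    have lens: "length es = Suc k" "length vs = Suc (Suc k)"
      and dv: "distinct vs" and esC: "set es \<subseteq> ?C"
      and ends: "\<And>i. i < Suc k \<Longrightarrow> {tail G (es ! i), head G (es ! i)} = {vs ! i, vs ! Suc i}"
      using q by (auto simp: P_def k_def)
    have "es ! k \<in> ?C" using esC lens by auto
    moreover have "vs ! Suc k = tail G (es ! k) \<or> vs ! Suc k = head G (es ! k)"
      using ends[of k] by (auto simp: doubleton_eq_iff)
    ultimately obtain f where f: "f \<in> ?C" "f \<noteq> es ! k" "vs ! Suc k = tail G f \<or> vs ! Suc k = head G f"
      using closed_chain_second_edge[OF G cl] noloop by metis
    have "\<exists>w. {tail G f, head G f} = {vs ! Suc k, w} \<and> w \<noteq> vs ! Suc k"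
      using f(3)
    proof
      assume "vs ! Suc k = tail G f"
      then show ?thesis using noloop[OF f(1)] by (intro exI[of _ "head G f"]) auto
    next
      assume "vs ! Suc k = head G f"
      then show ?thesis using noloop[OF f(1)] by (intro exI[of _ "tail G f"]) auto
    qed
    then obtain w where w: "{tail G f, head G f} = {vs ! Suc k, w}" "w \<noteq> vs ! Suc k"
      by blast
    show ?thesis
    proof (cases "w \<in> set vs")
      case False
      have "P (vs @ [w], es @ [f])"
        using q f w False ends lens
        by (auto simp: P_def nth_append less_Suc_eq)
      from max[OF this] show ?thesis by simp
    next
      case True
      then obtain i where i: "i < Suc (Suc k)" "w = vs ! i"
        using lens by (metis in_set_conv_nth)
      with w(2) have ik: "i \<le> k" by (metis less_Suc_eq_le le_SucE)
      \<comment> \<open>Only the last edge of the path touches its last vertex. For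
        \<open>i = k\<close> the resulting cycle is a pair of parallel edges.\<close>
      have "f \<notin> set (drop i es)"
      proof
        assume "f \<in> set (drop i es)"
        then obtain j where j: "j < Suc k" "f = es ! j"
          using lens by (metis in_set_conv_nth in_set_dropD)
        with f(2) have "j < k" using less_Suc_eq by blast
        have "vs ! Suc k \<in> {vs ! j, vs ! Suc j}"
          using w ends[OF j(1)] j(2) by auto
        with \<open>j < k\<close> dv lens show False
          by (auto simp: nth_eq_iff_index_eq)
      qed
      have "undirected_cycle G (drop i vs) (drop i es @ [f])"
        unfolding undirected_cycle_def
      proof (intro conjI allI impI)
        show "distinct (drop i es @ [f])"
          using distinct_es[of vs es] q \<open>f \<notin> set (drop i es)\<close> by simp
        show "set (drop i es @ [f]) \<subseteq> arcs G"
          using f(1) CG esC set_drop_subset[of i es] by auto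
        show "distinct (drop i vs)" using dv by simp
        show "length (drop i vs) = length (drop i es @ [f])"
          using lens ik by simp
        fix m assume "m < length (drop i es @ [f])"
        then have m: "m \<le> Suc k - i" using lens ik by auto
        show "{tail G ((drop i es @ [f]) ! m), head G ((drop i es @ [f]) ! m)} =
          {drop i vs ! m, drop i vs ! (Suc m mod length (drop i es @ [f]))}"
        proof (cases "m = Suc k - i")
          case True
          then show ?thesis
            using w(1) i lens ik by (simp add: nth_append)
        next
          case False
          then have "m < Suc k - i" using m by simp
          then show ?thesis
            using ends[of "i + m"] lens ik by (simp add: nth_append)
        qed
      qed simp
      moreover have "set (drop i es @ [f]) \<subseteq> ?C"
        using f(1) esC set_drop_subset[of i es] by auto
      ultimately show ?thesis by (rule girthI)
    qed
  qed
qed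

section \<open>Balls of the graph and potentials on them\<close>

definition adjacency :: "('v, 'e) pre_digraph \<Rightarrow> ('v \<times> 'v) set" where
  "adjacency G = (\<Union>e\<in>arcs G. {(tail G e, head G e), (head G e, tail G e)})"

definition graph_ball :: "('v, 'e) pre_digraph \<Rightarrow> 'v \<Rightarrow> nat \<Rightarrow> 'v set" where
  "graph_ball G r n = {x. \<exists>m\<le>n. (r, x) \<in> adjacency G ^^ m}"

lemma adjacency_sym: "(x, y) \<in> adjacency G \<Longrightarrow> (y, x) \<in> adjacency G"
  by (auto simp: adjacency_def)

lemma adjacency_relpow_sym: "(x, y) \<in> adjacency G ^^ m \<Longrightarrow> (y, x) \<in> adjacency G ^^ m"
proof (induction m arbitrary: y)
  case (Suc m)
  then obtain w where "(x, w) \<in> adjacency G ^^ m" "(w, y) \<in> adjacency G" by auto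
  with Suc.IH adjacency_sym show ?case by (metis relpow_Suc_I2)
qed auto

lemma graph_ball_trans: "x \<in> graph_ball G r m \<Longrightarrow> y \<in> graph_ball G x n \<Longrightarrow> y \<in> graph_ball G r (m + n)"
  unfolding graph_ball_def mem_Collect_eq
  by (metis add_mono relcomp.relcompI relpow_add)

lemma graph_ball_sym:
  assumes "x \<in> graph_ball G r n"
  shows "r \<in> graph_ball G x n"
proof -
  obtain m where m: "m \<le> n" "(r, x) \<in> adjacency G ^^ m"
    using assms by (auto simp: graph_ball_def)
  show ?thesis
    using m(1) adjacency_relpow_sym[OF m(2)]
    unfolding graph_ball_def mem_Collect_eq by (intro exI[of _ m] conjI)
qed

lemma graph_ball_mono: "m \<le> n \<Longrightarrow> graph_ball G r m \<subseteq> graph_ball G r n"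
  unfolding graph_ball_def using order_trans by blast

text \<open>The edges of the walk are added modulo 2. Repeated edges cancel, which only makes the
  support smaller.\<close>

lemma walk_chain:
  assumes G: "fin_digraph G" and "(r, x) \<in> adjacency G ^^ m"
  shows "\<exists>p. card (support G p) \<le> m \<and> (\<forall>y. boundary G p y = of_bool (y = r) + of_bool (y = x))"
  using assms(2)
proof (induction m arbitrary: x)
  case 0
  then show ?case
    by (intro exI[of _ "\<lambda>_. 0"]) (auto simp: support_def boundary_def)
next
  case (Suc m)
  then obtain w where "(r, w) \<in> adjacency G ^^ m" and w: "(w, x) \<in> adjacency G" by auto
  with Suc.IH obtain p where p: "card (support G p) \<le> m"
    "\<And>y. boundary G p y = of_bool (y = r) + of_bool (y = w)" by blast
  obtain e where e: "e \<in> arcs G" "{tail G e, head G e} = {w, x}"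
    using w by (auto simp: adjacency_def)
  interpret fin_digraph G by (rule G)
  have "support G (\<lambda>f. p f + of_bool (f = e)) \<subseteq> insert e (support G p)"
    by (auto simp: support_def)
  moreover have "finite (support G p)" by (simp add: support_def)
  ultimately have "card (support G (\<lambda>f. p f + of_bool (f = e))) \<le> card (insert e (support G p))"
    by (intro card_mono) auto
  also have "\<dots> \<le> Suc m"
    using p(1) \<open>finite (support G p)\<close> by (simp add: card_insert_if)
  finally have "card (support G (\<lambda>f. p f + of_bool (f = e))) \<le> Suc m" .
  moreover have "boundary G (\<lambda>f. p f + of_bool (f = e)) y = of_bool (y = r) + of_bool (y = x)" for y
  proof -
    have "boundary G (\<lambda>f. of_bool (f = e)) y = of_bool (y = w) + of_bool (y = x)"
      unfolding boundary_single[OF G e(1)] using e(2) by (auto simp: doubleton_eq_iff)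
    then show ?thesis
      by (simp only: boundary_add p(2) add.assoc bit_add_self_left)
  qed
  ultimately show ?case by blast
qed

text \<open>Choose for each \<open>x\<close> in the ball a chain from \<open>r\<close> to
  \<open>x\<close> with at most \<open>n\<close> edges, and let \<open>h x\<close> be its
  coefficient at \<open>e0\<close>. For an edge \<open>e\<close> inside the ball the chains to its
  two ends together with \<open>e\<close> form a closed chain with at most \<open>2 * n + 1\<close>
  edges, which is zero by the girth; its coefficient at \<open>e0\<close> is the claim.\<close>

lemma ball_cut_function:
  assumes G: "fin_digraph G" and "enat (2 * n + 1) < girth G" and e0: "e0 \<in> arcs G"
  shows "\<exists>h. \<forall>e\<in>arcs G. tail G e \<in> graph_ball G r n \<longrightarrow> head G e \<in> graph_ball G r n \<longrightarrow>
    h (tail G e) + h (head G e) = (of_bool (e = e0) :: bit)"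
proof -
  interpret fin_digraph G by (rule G)
  have "\<forall>x\<in>graph_ball G r n. \<exists>p. card (support G p) \<le> n \<and>
      (\<forall>y. boundary G p y = of_bool (y = r) + of_bool (y = x))"
    unfolding graph_ball_def using walk_chain[OF G, of r] order_trans by blast
  then obtain p where p: "\<And>x. x \<in> graph_ball G r n \<Longrightarrow> card (support G (p x)) \<le> n"
    "\<And>x y. x \<in> graph_ball G r n \<Longrightarrow> boundary G (p x) y = of_bool (y = r) + of_bool (y = x)"
    by metis
  have "p (tail G e) e0 + p (head G e) e0 = of_bool (e = e0)"
    if e: "e \<in> arcs G" and t: "tail G e \<in> graph_ball G r n" and h: "head G e \<in> graph_ball G r n" for e
  proof -
    define c where "c = (\<lambda>f. (p (tail G e) f + p (head G e) f) + of_bool (f = e))"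
    have "boundary G c x = 0" for x
      unfolding c_def boundary_add p(2)[OF t] p(2)[OF h] boundary_single[OF G e]
      by simp
    then have "closed_chain G c" by (simp add: closed_chain_def)
    have "support G c \<subseteq> insert e (support G (p (tail G e)) \<union> support G (p (head G e)))"
      by (auto simp: support_def c_def)
    moreover have fin: "finite (support G q)" for q by (simp add: support_def)
    ultimately have "card (support G c) \<le> card (insert e (support G (p (tail G e)) \<union> support G (p (head G e))))"
      by (intro card_mono) auto
    also have "\<dots> \<le> Suc (card (support G (p (tail G e)) \<union> support G (p (head G e))))"
      using fin by (simp add: card_insert_if)
    also have "\<dots> \<le> Suc (n + n)"
      using p(1)[OF t] p(1)[OF h] card_Un_le[of "support G (p (tail G e))" "support G (p (head G e))"] by linarith
    finally have "enat (card (support G c)) \<le> enat (2 * n + 1)" by simp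
    then have "\<not> girth G \<le> enat (card (support G c))"
      using assms(2) by (meson leD order_trans)
    then have "support G c = {}"
      using girth_le_card_support[OF G \<open>closed_chain G c\<close>] by blast
    then have "c e0 = 0" using e0 by (auto simp: support_def)
    then show ?thesis by (auto simp: c_def bit_add_eq_0_iff)
  qed
  then show ?thesis by (intro exI[of _ "\<lambda>x. p x e0"]) auto
qed

text \<open>A walk of length at most \<open>n\<close> from \<open>r\<close> never leaves the ball.
  Applied to the difference of two potentials of the same cocycle.\<close>

lemma constant_on_ball:
  assumes "\<And>e. e \<in> arcs G \<Longrightarrow> tail G e \<in> graph_ball G r n \<Longrightarrow> head G e \<in> graph_ball G r n \<Longrightarrow>
      g (tail G e) = g (head G e)"
    and "x \<in> graph_ball G r n"
  shows "g x = g r"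
proof -
  have "m \<le> n \<Longrightarrow> (r, x) \<in> adjacency G ^^ m \<Longrightarrow> g x = g r" for m
  proof (induction m arbitrary: x)
    case (Suc m)
    then obtain w where w: "(r, w) \<in> adjacency G ^^ m" "(w, x) \<in> adjacency G" by auto
    with Suc have "g w = g r" by simp
    moreover have "w \<in> graph_ball G r n" "x \<in> graph_ball G r n"
      using w(1) Suc.prems Suc_leD[of m n] unfolding graph_ball_def by blast+
    then have "g x = g w"
      using w(2) assms(1) unfolding adjacency_def by auto
    ultimately show ?case by simp
  qed auto
  then show ?thesis using assms(2) by (auto simp: graph_ball_def)
qed

text \<open>With \<open>T\<close> a maximal edge set carrying no nonzero closed chain,
  \<open>J\<close> is its complement: adding \<open>j\<close> to \<open>T\<close> creates a closed
  chain whose only edge outside \<open>T\<close> is \<open>j\<close>. The set \<open>T\<close> has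
  at most as many edges as there are vertices.\<close>

lemma fundamental_cycles:
  assumes G: "fin_digraph G"
  shows "\<exists>J cyc. J \<subseteq> arcs G \<and> card (arcs G) \<le> card J + card (verts G) \<and>
    (\<forall>j\<in>J. closed_chain G (cyc j) \<and> (\<forall>i\<in>J. cyc j i = of_bool (i = j)))"
proof -
  interpret fin_digraph G by (rule G)
  define acyc where "acyc = (\<lambda>T. T \<subseteq> arcs G \<and> (\<forall>c. support G c \<subseteq> T \<longrightarrow> closed_chain G c \<longrightarrow> support G c = {}))"
  have base: "acyc {}" by (auto simp: acyc_def)
  have bound: "\<forall>T. acyc T \<longrightarrow> card T < Suc (card (arcs G))"
    by (auto simp: acyc_def less_Suc_eq_le intro: card_mono)
  obtain T where T: "acyc T" and max: "\<And>T'. acyc T' \<Longrightarrow> card T' \<le> card T"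
    using ex_has_greatest_nat[where f = card, OF base bound] by auto
  have TG: "T \<subseteq> arcs G" and finT: "finite T"
    using T finite_subset[of T "arcs G"] by (auto simp: acyc_def)
  \<comment> \<open>Two subsets of \<open>T\<close> with the same boundary differ by a closed chain
    in \<open>T\<close>, which is zero. Counting subsets replaces a dimension argument.\<close>
  have "inj_on (\<lambda>A. {x \<in> verts G. boundary G (\<lambda>e. of_bool (e \<in> A)) x \<noteq> 0}) (Pow T)"
  proof (rule inj_onI)
    fix A B assume AB: "A \<in> Pow T" "B \<in> Pow T"
      and eq: "{x \<in> verts G. boundary G (\<lambda>e. of_bool (e \<in> A)) x \<noteq> 0} =
        {x \<in> verts G. boundary G (\<lambda>e. of_bool (e \<in> B)) x \<noteq> 0}"
    let ?c = "\<lambda>e. of_bool (e \<in> A) + of_bool (e \<in> B) :: bit"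
    have "boundary G (\<lambda>e. of_bool (e \<in> A)) x = boundary G (\<lambda>e. of_bool (e \<in> B)) x" if "x \<in> verts G" for x
      using eq that by (intro bit_eqI_nonzero) blast
    then have "closed_chain G ?c"
      by (simp add: closed_chain_def boundary_add)
    moreover have "support G ?c \<subseteq> T" using AB by (auto simp: support_def)
    ultimately have "support G ?c = {}" using T by (auto simp: acyc_def)
    then have "?c e = 0" if "e \<in> arcs G" for e using that by (auto simp: support_def)
    then show "A = B"
      using AB TG by (fastforce simp: bit_add_eq_0_iff)
  qed
  then have "card (Pow T) \<le> card (Pow (verts G))"
    by (rule card_inj_on_le) auto
  then have "card T \<le> card (verts G)"
    using finT by (simp add: card_Pow)
  moreover have "card (arcs G) = card (arcs G - T) + card T"
    using TG finT by (simp add: card_Diff_subset card_mono)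
  moreover have "\<exists>c. closed_chain G c \<and> (\<forall>i\<in>arcs G - T. c i = of_bool (i = j))" if j: "j \<in> arcs G - T" for j
  proof -
    have "\<not> acyc (insert j T)"
      using max[of "insert j T"] j finT by auto
    then obtain c where c: "support G c \<subseteq> insert j T" "closed_chain G c" "support G c \<noteq> {}"
      using j TG by (auto simp: acyc_def)
    then have "j \<in> support G c"
      using T by (auto simp: acyc_def)
    then have "c i = of_bool (i = j)" if "i \<in> arcs G - T" for i
      using that c(1) by (auto simp: support_def)
    with c(2) show ?thesis by blast
  qed
  then obtain cyc where "\<And>j. j \<in> arcs G - T \<Longrightarrow>
      closed_chain G (cyc j) \<and> (\<forall>i\<in>arcs G - T. cyc j i = of_bool (i = j))"
    by metis
  ultimately show ?thesis
    by (intro exI[of _ "arcs G - T"] exI[of _ cyc]) auto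
qed

text \<open>Each subset \<open>A\<close> of \<open>J \<times> J\<close> yields the 2-cycle
  \<open>z A\<close>, and there are more such subsets than restrictions to \<open>B\<close>. Two of
  them therefore agree on \<open>B\<close>; their sum vanishes on \<open>B\<close>, but not
  everywhere.\<close>

lemma product_cycle_avoiding:
  assumes G: "fin_digraph G" and B: "finite B"
    and few: "card B < (card (arcs G) - card (verts G))\<^sup>2"
  shows "\<exists>z :: 'e \<Rightarrow> 'e \<Rightarrow> bit. (\<forall>e'. closed_chain G (\<lambda>e. z e e')) \<and> (\<forall>e. closed_chain G (z e)) \<and>
    (\<forall>(e, e')\<in>B. z e e' = 0) \<and> (\<exists>e\<in>arcs G. \<exists>e'\<in>arcs G. z e e' \<noteq> 0)"
proof -
  interpret fin_digraph G by (rule G)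
  obtain J cyc where J: "J \<subseteq> arcs G" "card (arcs G) \<le> card J + card (verts G)"
    and cyc: "\<And>j. j \<in> J \<Longrightarrow> closed_chain G (cyc j)" "\<And>i j. j \<in> J \<Longrightarrow> i \<in> J \<Longrightarrow> cyc j i = of_bool (i = j)"
    using fundamental_cycles[OF G] by blast
  have finJ: "finite J" using finite_subset[OF J(1)] by simp
  define z where "z = (\<lambda>A e e'. \<Sum>(j, j')\<in>A. cyc j e * cyc j' e')"
  have z1: "closed_chain G (\<lambda>e. z A e e')" if "A \<subseteq> J \<times> J" for A e'
  proof -
    have "closed_chain G (\<lambda>e. \<Sum>p\<in>A. cyc (snd p) e' * cyc (fst p) e)"
      by (rule closed_chain_sum) (use that cyc(1) in auto)
    then show ?thesis by (simp only: z_def case_prod_unfold mult.commute)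
  qed
  have z2: "closed_chain G (z A e)" if "A \<subseteq> J \<times> J" for A e
  proof -
    have "closed_chain G (\<lambda>e'. \<Sum>p\<in>A. cyc (fst p) e * cyc (snd p) e')"
      by (rule closed_chain_sum) (use that cyc(1) in auto)
    then show ?thesis by (simp only: z_def case_prod_unfold)
  qed
  \<comment> \<open>The set \<open>A\<close> can be read off from the values of \<open>z A\<close>
    on \<open>J \<times> J\<close>, so different sets give different cycles.\<close>
  have zJ: "z A i i' = of_bool ((i, i') \<in> A)" if A: "A \<subseteq> J \<times> J" and i: "i \<in> J" "i' \<in> J" for A i i'
  proof -
    have "z A i i' = (\<Sum>p\<in>A. if (i, i') = p then 1 else 0)"
      unfolding z_def
    proof (intro sum.cong refl)
      fix p assume "p \<in> A"
      then obtain j j' where "p = (j, j')" "j \<in> J" "j' \<in> J" using A by blast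
      then show "(case p of (j, j') \<Rightarrow> cyc j i * cyc j' i') = (if (i, i') = p then 1 else 0)"
        using cyc(2) i by auto
    qed
    also have "\<dots> = of_bool ((i, i') \<in> A)"
      using finite_subset[OF A] finJ by simp
    finally show ?thesis .
  qed
  have "\<not> inj_on (\<lambda>A. {(e, e') \<in> B. z A e e' \<noteq> 0}) (Pow (J \<times> J))"
  proof
    assume "inj_on (\<lambda>A. {(e, e') \<in> B. z A e e' \<noteq> 0}) (Pow (J \<times> J))"
    then have "card (Pow (J \<times> J)) \<le> card (Pow B)"
      by (rule card_inj_on_le) (use B in auto)
    then have "card J * card J \<le> card B"
      using finJ B by (simp add: card_Pow card_cartesian_product)
    moreover have "(card (arcs G) - card (verts G))\<^sup>2 \<le> (card J)\<^sup>2"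
      using J(2) by (intro power_mono) auto
    ultimately show False using few by (simp add: power2_eq_square)
  qed
  then obtain A A' where A: "A \<subseteq> J \<times> J" "A' \<subseteq> J \<times> J" "A \<noteq> A'"
    and eq: "{(e, e') \<in> B. z A e e' \<noteq> 0} = {(e, e') \<in> B. z A' e e' \<noteq> 0}"
    unfolding inj_on_def by blast
  have B0: "z A e e' + z A' e e' = 0" if "(e, e') \<in> B" for e e'
  proof -
    have "(e, e') \<in> {(e, e') \<in> B. z A e e' \<noteq> 0} \<longleftrightarrow> (e, e') \<in> {(e, e') \<in> B. z A' e e' \<noteq> 0}"
      by (simp only: eq)
    with that show ?thesis
      by (cases "z A e e'"; cases "z A' e e'") auto
  qed
  obtain i i' where i: "i \<in> J" "i' \<in> J" "(i, i') \<in> A \<longleftrightarrow> (i, i') \<notin> A'"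
    using A by blast
  then have "z A i i' + z A' i i' \<noteq> 0"
    by (cases "(i, i') \<in> A") (simp_all add: zJ[OF A(1)] zJ[OF A(2)])
  then have "\<exists>e\<in>arcs G. \<exists>e'\<in>arcs G. z A e e' + z A' e e' \<noteq> 0"
    using i J(1) by blast
  then show ?thesis
    using B0 z1[OF A(1)] z1[OF A(2)] z2[OF A(1)] z2[OF A(2)]
    by (intro exI[of _ "\<lambda>e e'. z A e e' + z A' e e'"]) (simp add: closed_chain_add split_beta)
qed

lemma regular_graph_handshake:
  assumes G: "fin_digraph G" and reg: "regular_graph d G"
  shows "2 * card (arcs G) = d * card (verts G)"
proof -
  interpret fin_digraph G by (rule G)
  have part: "(\<Sum>v\<in>verts G. card {e \<in> arcs G. f e = v}) = card (arcs G)"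
    if "f ` arcs G \<subseteq> verts G" for f
  proof -
    have "(\<Sum>v\<in>verts G. card {e \<in> arcs G. f e = v}) = card (\<Union>v\<in>verts G. {e \<in> arcs G. f e = v})"
      by (rule card_UN_disjoint[symmetric]) auto
    also have "(\<Union>v\<in>verts G. {e \<in> arcs G. f e = v}) = arcs G"
      using that by auto
    finally show ?thesis .
  qed
  have sub: "tail G ` arcs G \<subseteq> verts G" "head G ` arcs G \<subseteq> verts G" by auto
  have "d * card (verts G) = (\<Sum>v\<in>verts G. in_degree G v + out_degree G v)"
    using reg by (simp add: regular_graph_def)
  also have "\<dots> = 2 * card (arcs G)"
    using part[OF sub(1)] part[OF sub(2)]
    by (simp add: sum.distrib in_degree_def out_degree_def in_arcs_def out_arcs_def)
  finally show ?thesis by simp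
qed

lemma regular_graph_card_incident:
  assumes "regular_graph d G" "v \<in> verts G"
  shows "card {e \<in> arcs G. tail G e = v \<or> head G e = v} \<le> d"
proof -
  have "{e \<in> arcs G. tail G e = v \<or> head G e = v} = in_arcs G v \<union> out_arcs G v"
    by (auto simp: in_arcs_def out_arcs_def)
  then show ?thesis
    using card_Un_le[of "in_arcs G v" "out_arcs G v"] assms
    by (simp add: regular_graph_def in_degree_def out_degree_def)
qed

section \<open>The path metric\<close>

lemma connected_adjacency_rtrancl:
  assumes "Digraph_Component.connected G" "u \<in> verts G" "v \<in> verts G"
  shows "(u, v) \<in> (adjacency G)\<^sup>*"
proof -
  have "(u, v) \<in> rtrancl_on (verts G) (adjacency G)"
    using assms
    by (auto simp: connected_def strongly_connected_def reachable_def adjacency_def parcs_mk_symmetric)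
  then show ?thesis by (rule rtrancl_on_rtranclI)
qed

lemma edge_map_in_graph_points: "e \<in> arcs G \<Longrightarrow> t \<in> {0..1} \<Longrightarrow> edge_map G e t \<in> graph_points G"
  unfolding graph_points_def by blast

lemma edge_map_0 [simp]: "edge_map G e 0 = Vertex (tail G e)"
  and edge_map_1 [simp]: "edge_map G e 1 = Vertex (head G e)"
  by (simp_all add: edge_map_def)

lemma pl_path_nonneg: "pl_path G x l y \<Longrightarrow> 0 \<le> l"
  by (induction rule: pl_path.induct) auto

lemma pl_path_edge:
  "e \<in> arcs G \<Longrightarrow> s \<in> {0..1} \<Longrightarrow> t \<in> {0..1} \<Longrightarrow> pl_path G (edge_map G e s) \<bar>s - t\<bar> (edge_map G e t)"
  using pl_path.segment[OF pl_path.trivial[OF edge_map_in_graph_points[of e G s]]] by simp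

lemma pl_path_trans:
  assumes "pl_path G y m w" "pl_path G x l y" shows "pl_path G x (l + m) w"
  using assms
proof (induction rule: pl_path.induct)
  case (segment y m e s t)
  then show ?case
    using pl_path.segment[of G x "l + m" e s t] by (simp add: add.assoc)
qed simp

lemma pl_path_sym: "pl_path G x l y \<Longrightarrow> pl_path G y l x"
proof (induction rule: pl_path.induct)
  case (segment x l e s t)
  then show ?case
    using pl_path_trans[OF segment.IH pl_path_edge[of e G t s]] by (simp add: add.commute abs_minus_commute)
qed (rule pl_path.trivial)

lemma pl_path_adjacency:
  assumes "(u, v) \<in> (adjacency G)\<^sup>*" "u \<in> verts G"
  shows "\<exists>l. pl_path G (Vertex u) l (Vertex v)"
  using assms(1)
proof (induction rule: rtrancl_induct)
  case base
  then show ?case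
    using assms(2) by (auto intro!: exI[of _ 0] pl_path.trivial simp: graph_points_def)
next
  case (step v w)
  then obtain l e where "pl_path G (Vertex u) l (Vertex v)" and e: "e \<in> arcs G"
    and "v = tail G e \<and> w = head G e \<or> v = head G e \<and> w = tail G e"
    by (auto simp: adjacency_def)
  moreover have "pl_path G (Vertex (tail G e)) 1 (Vertex (head G e))"
    using pl_path_edge[OF e, of 0 1] by simp
  ultimately show ?case
    using pl_path_trans pl_path_sym by metis
qed

lemma pl_path_exists:
  assumes wf: "wf_digraph G" and conn: "Digraph_Component.connected G"
    and "x \<in> graph_points G" "y \<in> graph_points G"
  shows "\<exists>l. pl_path G x l y"
proof -
  have to_vertex: "\<exists>l. \<exists>v\<in>verts G. pl_path G x l (Vertex v)" if "x \<in> graph_points G" for x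
  proof -
    consider v where "v \<in> verts G" "x = Vertex v" | e t where "e \<in> arcs G" "t \<in> {0..1}" "x = edge_map G e t"
      using \<open>x \<in> graph_points G\<close> unfolding graph_points_def by blast
    then show ?thesis
    proof cases
      case 1
      then show ?thesis using pl_path.trivial[OF \<open>x \<in> graph_points G\<close>] by blast
    next
      case 2
      then have "pl_path G x \<bar>t - 0\<bar> (Vertex (tail G e))"
        using pl_path_edge[of e G t 0] by simp
      then show ?thesis using wf_digraph.tail_in_verts[OF wf 2(1)] by blast
    qed
  qed
  obtain l u m v where u: "u \<in> verts G" and v: "v \<in> verts G" and "pl_path G x l (Vertex u)" "pl_path G y m (Vertex v)"
    using to_vertex assms(3,4) by blast
  moreover obtain k where "pl_path G (Vertex u) k (Vertex v)"
    using pl_path_adjacency[OF connected_adjacency_rtrancl[OF conn u v] u] by blast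
  ultimately show ?thesis
    by (meson pl_path_trans pl_path_sym)
qed

lemma path_metric_sym: "path_metric G x y = path_metric G y x"
proof -
  have "{l. pl_path G x l y} = {l. pl_path G y l x}"
    using pl_path_sym by blast
  then show ?thesis by (simp add: path_metric_def)
qed

lemma bdd_below_pl_path: "bdd_below {l. pl_path G x l y}"
  by (rule bdd_belowI[of _ 0]) (auto intro: pl_path_nonneg)

lemma path_metric_le: "pl_path G x l y \<Longrightarrow> path_metric G x y \<le> l"
  unfolding path_metric_def by (rule cInf_lower[OF _ bdd_below_pl_path]) simp

lemma path_metric_edge_le:
  "e \<in> arcs G \<Longrightarrow> s \<in> {0..1} \<Longrightarrow> t \<in> {0..1} \<Longrightarrow> path_metric G (edge_map G e s) (edge_map G e t) \<le> \<bar>s - t\<bar>"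
  by (intro path_metric_le pl_path_edge)

section \<open>Lower bounds for the path metric by Lipschitz functions\<close>

definition edge_lipschitz :: "('v, 'e) pre_digraph \<Rightarrow> (('v, 'e) graph_point \<Rightarrow> real) \<Rightarrow> bool" where
  "edge_lipschitz G \<psi> \<longleftrightarrow> (\<forall>e\<in>arcs G. \<forall>s\<in>{0..1}. \<forall>t\<in>{0..1}.
     \<bar>\<psi> (edge_map G e s) - \<psi> (edge_map G e t)\<bar> \<le> \<bar>s - t\<bar>)"

text \<open>Since the path metric is an infimum, lower bounds for it come from test functions: the
  change of such a function along a path is at most the length of the path.\<close>

lemma pl_path_lipschitz:
  "pl_path G x l y \<Longrightarrow> edge_lipschitz G \<psi> \<Longrightarrow> \<bar>\<psi> x - \<psi> y\<bar> \<le> l"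
proof (induction rule: pl_path.induct)
  case (segment x l e s t)
  then have "\<bar>\<psi> (edge_map G e s) - \<psi> (edge_map G e t)\<bar> \<le> \<bar>s - t\<bar>"
    by (simp add: edge_lipschitz_def)
  with segment show ?case by linarith
qed simp

text \<open>This function vanishes only at \<open>Inner e s\<close>, so its Lipschitz property separates that point from all others.\<close>

definition bump :: "'e \<Rightarrow> real \<Rightarrow> ('v, 'e) graph_point \<Rightarrow> real" where
  "bump e s y = (case y of Vertex v \<Rightarrow> min s (1 - s)
    | Inner f t \<Rightarrow> if f = e then min \<bar>t - s\<bar> (min s (1 - s)) else min s (1 - s))"

lemma bump_lipschitz:
  assumes "s \<in> {0..1}"
  shows "edge_lipschitz G (bump e s)"
proof -
  have "bump e s (edge_map G f t) = (if f = e then min \<bar>t - s\<bar> (min s (1 - s)) else min s (1 - s))"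
    if "t \<in> {0..1}" for f t
    using that assms by (auto simp: bump_def edge_map_def)
  then show ?thesis
    unfolding edge_lipschitz_def by (auto simp: min_def)
qed

definition graph_dist :: "('v, 'e) pre_digraph \<Rightarrow> 'v \<Rightarrow> 'v \<Rightarrow> nat" where
  "graph_dist G r x = (LEAST n. (r, x) \<in> adjacency G ^^ n)"

definition vertex_dist :: "('v, 'e) pre_digraph \<Rightarrow> 'v \<Rightarrow> ('v, 'e) graph_point \<Rightarrow> real" where
  "vertex_dist G r y = (case y of Vertex v \<Rightarrow> real (graph_dist G r v)
    | Inner e t \<Rightarrow> min (real (graph_dist G r (tail G e)) + t) (real (graph_dist G r (head G e)) + 1 - t))"

context
  fixes G :: "('v, 'e) pre_digraph"
  assumes G: "fin_digraph G" and conn: "Digraph_Component.connected G"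
begin

interpretation fin_digraph G by (rule G)

lemma graph_dist_relpow:
  assumes "r \<in> verts G" "x \<in> verts G"
  shows "(r, x) \<in> adjacency G ^^ graph_dist G r x"
  unfolding graph_dist_def
  by (rule LeastI_ex) (use connected_adjacency_rtrancl[OF conn assms] in \<open>simp add: rtrancl_power\<close>)

lemma graph_dist_step:
  assumes "r \<in> verts G" "(x, y) \<in> adjacency G"
  shows "graph_dist G r y \<le> Suc (graph_dist G r x)"
proof -
  have "x \<in> verts G" using assms(2) by (auto simp: adjacency_def)
  then have "(r, y) \<in> adjacency G ^^ Suc (graph_dist G r x)"
    using graph_dist_relpow[OF assms(1)] assms(2) by (metis relpow_Suc_I)
  then show ?thesis
    unfolding graph_dist_def[of G r y] by (rule Least_le)
qed

text \<open>The formula for inner points stays correct at \<open>t = 0\<close> and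
  \<open>t = 1\<close> because the graph distances of adjacent vertices differ by at most
  one.\<close>

lemma vertex_dist_edge_map:
  assumes r: "r \<in> verts G" and e: "e \<in> arcs G" and t: "t \<in> {0..1}"
  shows "vertex_dist G r (edge_map G e t) =
    min (real (graph_dist G r (tail G e)) + t) (real (graph_dist G r (head G e)) + 1 - t)"
proof -
  have "(tail G e, head G e) \<in> adjacency G" "(head G e, tail G e) \<in> adjacency G"
    using e by (auto simp: adjacency_def)
  then have "graph_dist G r (head G e) \<le> Suc (graph_dist G r (tail G e))"
      "graph_dist G r (tail G e) \<le> Suc (graph_dist G r (head G e))"
    using graph_dist_step[OF r] by auto
  then show ?thesis
    using t by (auto simp: vertex_dist_def edge_map_def)
qed

lemma vertex_dist_lipschitz: "r \<in> verts G \<Longrightarrow> edge_lipschitz G (vertex_dist G r)"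
  unfolding edge_lipschitz_def
proof (intro ballI)
  fix e and s t :: real assume "r \<in> verts G" "e \<in> arcs G" "s \<in> {0..1}" "t \<in> {0..1}"
  then show "\<bar>vertex_dist G r (edge_map G e s) - vertex_dist G r (edge_map G e t)\<bar> \<le> \<bar>s - t\<bar>"
    unfolding vertex_dist_edge_map[OF \<open>r \<in> verts G\<close> \<open>e \<in> arcs G\<close> \<open>s \<in> {0..1}\<close>]
      vertex_dist_edge_map[OF \<open>r \<in> verts G\<close> \<open>e \<in> arcs G\<close> \<open>t \<in> {0..1}\<close>]
    by (auto simp: min_def)
qed

lemma graph_dist_self: "graph_dist G r r = 0"
  unfolding graph_dist_def by (rule Least_eq_0) simp

lemma graph_dist_eq_0: "r \<in> verts G \<Longrightarrow> x \<in> verts G \<Longrightarrow> graph_dist G r x = 0 \<longleftrightarrow> x = r"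
  using graph_dist_relpow[of r x] graph_dist_self by force

lemma path_metric_witness:
  assumes "x \<in> graph_points G" "y \<in> graph_points G" "0 < \<epsilon>"
  obtains l where "pl_path G x l y" "l < path_metric G x y + \<epsilon>"
proof -
  have "{l. pl_path G x l y} \<noteq> {}"
    using pl_path_exists[OF wf_digraph conn assms(1,2)] by auto
  then have "\<exists>l\<in>{l. pl_path G x l y}. l < path_metric G x y + \<epsilon>"
    using assms(3) unfolding path_metric_def by (intro cInf_lessD) auto
  then show ?thesis using that by auto
qed

lemma path_metric_nonneg: "x \<in> graph_points G \<Longrightarrow> y \<in> graph_points G \<Longrightarrow> 0 \<le> path_metric G x y"
  unfolding path_metric_def
  using pl_path_exists[OF wf_digraph conn] pl_path_nonneg by (intro cInf_greatest) auto

lemma path_metric_triangle: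
  assumes "x \<in> graph_points G" "y \<in> graph_points G" "w \<in> graph_points G"
  shows "path_metric G x w \<le> path_metric G x y + path_metric G y w"
proof (rule field_le_epsilon)
  fix \<epsilon> :: real assume "0 < \<epsilon>"
  then have "0 < \<epsilon> / 2" by simp
  obtain l where l: "pl_path G x l y" "l < path_metric G x y + \<epsilon> / 2"
    using path_metric_witness[OF assms(1,2) \<open>0 < \<epsilon> / 2\<close>] by blast
  obtain m where m: "pl_path G y m w" "m < path_metric G y w + \<epsilon> / 2"
    using path_metric_witness[OF assms(2,3) \<open>0 < \<epsilon> / 2\<close>] by blast
  have "path_metric G x w \<le> l + m"
    by (intro path_metric_le pl_path_trans[OF m(1) l(1)])
  with l(2) m(2) show "path_metric G x w \<le> path_metric G x y + path_metric G y w + \<epsilon>" by simp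
qed

lemma path_metric_lipschitz:
  assumes "edge_lipschitz G \<psi>" "x \<in> graph_points G" "y \<in> graph_points G"
  shows "\<bar>\<psi> x - \<psi> y\<bar> \<le> path_metric G x y"
proof (rule field_le_epsilon)
  fix \<epsilon> :: real assume "0 < \<epsilon>"
  obtain l where "pl_path G x l y" "l < path_metric G x y + \<epsilon>"
    using path_metric_witness[OF assms(2,3) \<open>0 < \<epsilon>\<close>] by blast
  with pl_path_lipschitz[OF _ assms(1)] show "\<bar>\<psi> x - \<psi> y\<bar> \<le> path_metric G x y + \<epsilon>" by fastforce
qed

lemma graph_points_cases:
  assumes "x \<in> graph_points G"
  obtains v where "v \<in> verts G" "x = Vertex v" | e t where "e \<in> arcs G" "0 < t" "t < 1" "x = Inner e t"
proof -
  consider v where "v \<in> verts G" "x = Vertex v" | e t where "e \<in> arcs G" "t \<in> {0..1}" "x = edge_map G e t"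
    using assms unfolding graph_points_def by blast
  then show ?thesis
  proof cases
    case 2
    then show ?thesis
      using that(1)[OF tail_in_verts[OF 2(1)]] that(1)[OF head_in_verts[OF 2(1)]] that(2)[OF 2(1)]
      by (auto simp: edge_map_def split: if_splits)
  qed (use that in blast)
qed

text \<open>Test functions separate points: the distance from \<open>v\<close> if \<open>x\<close>
  is the vertex \<open>v\<close>, and \<open>bump\<close> if \<open>x\<close> is an inner
  point.\<close>

lemma path_metric_eq_0D:
  assumes x: "x \<in> graph_points G" and y: "y \<in> graph_points G" and 0: "path_metric G x y = 0"
  shows "x = y"
  using x
proof (cases rule: graph_points_cases)
  case (1 v)
  have "vertex_dist G v x = vertex_dist G v y"
    using path_metric_lipschitz[OF vertex_dist_lipschitz[OF 1(1)] x y] 0 by simp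
  then have "vertex_dist G v y = 0"
    using 1 by (simp add: vertex_dist_def graph_dist_self)
  with y show ?thesis
    by (cases rule: graph_points_cases) (use 1 in \<open>auto simp: vertex_dist_def graph_dist_eq_0 min_def split: if_splits\<close>)
next
  case (2 e t)
  have "bump e t x = bump e t y"
    using path_metric_lipschitz[OF bump_lipschitz[of t G e] x y] 0 2 by simp
  then show ?thesis
    using 2 by (auto simp: bump_def min_def split: graph_point.splits if_splits)
qed

lemma path_metric_self: "x \<in> graph_points G \<Longrightarrow> path_metric G x x = 0"
  using path_metric_le[OF pl_path.trivial[of x G]] path_metric_nonneg[of x x] by simp

text \<open>
  Outside \<open>graph_points G\<close> the path metric is the unspecified value \<open>Inf {}\<close>, so that it may be
  negative there; the product metric is nonnegative everywhere nevertheless.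
\<close>

lemma Metric_space_product:
  "Metric_space (graph_points G \<times> graph_points G) (prod_dist (path_metric G) (path_metric G))"
proof -
  let ?P = "graph_points G"
  let ?d = "\<lambda>x y. if x \<in> ?P \<and> y \<in> ?P then path_metric G x y else 0"
  interpret M: Metric_space ?P ?d
    by unfold_locales
      (auto simp: path_metric_nonneg path_metric_sym path_metric_self path_metric_triangle dest: path_metric_eq_0D)
  interpret MM: Metric_space12 ?P ?d ?P ?d ..
  have eq: "prod_dist (path_metric G) (path_metric G) p q = prod_dist ?d ?d p q"
    if "p \<in> ?P \<times> ?P" "q \<in> ?P \<times> ?P" for p q
    using that by (auto simp: prod_dist_def)
  show ?thesis
  proof
    show "0 \<le> prod_dist (path_metric G) (path_metric G) p q" for p q
      by (auto simp: prod_dist_def case_prod_unfold)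
    show "prod_dist (path_metric G) (path_metric G) p q = prod_dist (path_metric G) (path_metric G) q p" for p q
      using path_metric_sym[of G] by (auto simp: prod_dist_def case_prod_unfold)
    show "prod_dist (path_metric G) (path_metric G) p q = 0 \<longleftrightarrow> p = q"
      if "p \<in> ?P \<times> ?P" "q \<in> ?P \<times> ?P" for p q
      unfolding eq[OF that] by (rule MM.Prod_metric.zero[OF that])
    show "prod_dist (path_metric G) (path_metric G) p r \<le>
        prod_dist (path_metric G) (path_metric G) p q + prod_dist (path_metric G) (path_metric G) q r"
      if "p \<in> ?P \<times> ?P" "q \<in> ?P \<times> ?P" "r \<in> ?P \<times> ?P" for p q r
      unfolding eq[OF that(1,2)] eq[OF that(1,3)] eq[OF that(2,3)] by (rule MM.Prod_metric.triangle[OF that])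
  qed
qed

text \<open>Measured from \<open>tail G e\<close>, the point on \<open>e\<close> is at distance at
  most 1, so the point on \<open>f\<close> is at distance less than \<open>n + 1\<close>. Passing
  from it to the ends of \<open>f\<close> accounts for the remaining slack.\<close>

lemma graph_ball_if_path_metric_less:
  assumes e: "e \<in> arcs G" "s \<in> {0..1}" and f: "f \<in> arcs G" "t \<in> {0..1}"
    and less: "path_metric G (edge_map G e s) (edge_map G f t) < real n"
  shows "tail G f \<in> graph_ball G (tail G e) (n + 2)" "head G f \<in> graph_ball G (tail G e) (n + 3)"
proof -
  let ?r = "tail G e"
  have r: "?r \<in> verts G" using e by simp
  have "vertex_dist G ?r (edge_map G e s) \<le> 1"
    using e unfolding vertex_dist_edge_map[OF r e] by (simp add: graph_dist_self min_le_iff_disj)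
  moreover have "\<bar>vertex_dist G ?r (edge_map G e s) - vertex_dist G ?r (edge_map G f t)\<bar> < real n"
    using path_metric_lipschitz[OF vertex_dist_lipschitz[OF r]] e f less
    by (meson edge_map_in_graph_points order_le_less_trans)
  ultimately have 1: "vertex_dist G ?r (edge_map G f t) < real n + 1" by linarith
  have adj: "(head G f, tail G f) \<in> adjacency G" "(tail G f, head G f) \<in> adjacency G"
    using f by (auto simp: adjacency_def)
  then have "graph_dist G ?r (tail G f) \<le> Suc (graph_dist G ?r (head G f))"
    by (intro graph_dist_step r)
  with 1 have "graph_dist G ?r (tail G f) < n + 2"
    unfolding vertex_dist_edge_map[OF r f] using f by (auto simp: min_less_iff_disj)
  then have le: "graph_dist G ?r (tail G f) \<le> n + 2" "graph_dist G ?r (head G f) \<le> n + 3"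
    using graph_dist_step[OF r adj(2)] by auto
  show "tail G f \<in> graph_ball G ?r (n + 2)" "head G f \<in> graph_ball G ?r (n + 3)"
    using le graph_dist_relpow[OF r, of "tail G f"] graph_dist_relpow[OF r, of "head G f"] f
    unfolding graph_ball_def by auto
qed

end

section \<open>Covers of one-dimensional polyhedra\<close>

text \<open>Turns continuity into the weak topology into continuity of real functions, the form in
  which compactness is applied.\<close>

lemma continuous_map_barycentric_coordinate:
  "continuous_map (polyhedron_topology K) euclideanreal (\<lambda>x. x v)"
  unfolding continuous_map
proof (intro conjI allI impI)
  fix U :: "real set" assume "openin euclideanreal U"
  then have "open U" by simp
  show "openin (polyhedron_topology K) {x \<in> topspace (polyhedron_topology K). x v \<in> U}"
    unfolding openin_polyhedron_topology
  proof (intro conjI ballI)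
    fix \<sigma> assume "\<sigma> \<in> K"
    then have "{x \<in> topspace (polyhedron_topology K). x v \<in> U} \<inter> closed_simplex \<sigma> =
        closed_simplex \<sigma> \<inter> (\<lambda>x. x v) -` U"
      by (auto simp: polyhedron_of_def)
    moreover have "open ((\<lambda>x :: 'a \<Rightarrow> real. x v) -` U)"
      by (rule open_vimage[OF \<open>open U\<close>]) simp
    ultimately show "openin (top_of_set (closed_simplex \<sigma>))
        ({x \<in> topspace (polyhedron_topology K). x v \<in> U} \<inter> closed_simplex \<sigma>)"
      by (simp add: openin_open_Int)
  qed auto
qed simp

text \<open>
  The points at distance less than \<open>1/m\<close> from the lattice point \<open>\<kappa>/m\<close>.  Below \<open>m\<close> is even, and only
  those \<open>\<kappa>\<close> are used that are even everywhere or odd at the two ends of an edge of the complex: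
  either kind yields a disjoint family of open sets, and together they cover.
\<close>

definition lattice_nbhd :: "'k set set \<Rightarrow> nat \<Rightarrow> ('k \<Rightarrow> int) \<Rightarrow> ('k \<Rightarrow> real) set" where
  "lattice_nbhd K m \<kappa> = {x \<in> polyhedron_of K. \<forall>v. \<bar>real m * x v - of_int (\<kappa> v)\<bar> < 1}"

definition even_label :: "('k \<Rightarrow> int) \<Rightarrow> bool" where
  "even_label \<kappa> \<longleftrightarrow> (\<forall>v. even (\<kappa> v))"

definition odd_label :: "('k \<Rightarrow> int) \<Rightarrow> bool" where
  "odd_label \<kappa> \<longleftrightarrow> (\<exists>u w. u \<noteq> w \<and> odd (\<kappa> u) \<and> odd (\<kappa> w) \<and> 0 < \<kappa> u \<and> 0 < \<kappa> w \<and>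
     (\<forall>v. v \<noteq> u \<longrightarrow> v \<noteq> w \<longrightarrow> \<kappa> v = 0))"

text \<open>The condition concerns all, possibly infinitely many, coordinates, but openness is
  tested on one finite simplex at a time. Outside \<open>\<sigma>\<close> the coordinates are zero,
  so there either the condition holds trivially or some nonzero \<open>\<kappa> v\<close> makes the
  intersection empty.\<close>

lemma openin_lattice_nbhd:
  assumes "\<And>\<sigma>. \<sigma> \<in> K \<Longrightarrow> finite \<sigma>"
  shows "openin (polyhedron_topology K) (lattice_nbhd K m \<kappa>)"
  unfolding openin_polyhedron_topology
proof (intro conjI ballI)
  fix \<sigma> assume \<sigma>: "\<sigma> \<in> K"
  show "openin (top_of_set (closed_simplex \<sigma>)) (lattice_nbhd K m \<kappa> \<inter> closed_simplex \<sigma>)"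
  proof (cases "\<forall>v. v \<notin> \<sigma> \<longrightarrow> \<kappa> v = 0")
    case True
    have "lattice_nbhd K m \<kappa> \<inter> closed_simplex \<sigma> =
        closed_simplex \<sigma> \<inter> (\<Inter>v\<in>\<sigma>. {x. \<bar>real m * x v - of_int (\<kappa> v)\<bar> < 1})"
    proof (intro equalityI subsetI)
      fix x assume x: "x \<in> closed_simplex \<sigma> \<inter> (\<Inter>v\<in>\<sigma>. {x. \<bar>real m * x v - of_int (\<kappa> v)\<bar> < 1})"
      then have "x v = 0" if "v \<notin> \<sigma>" for v
        using that by (auto simp: closed_simplex_def)
      then have "\<bar>real m * x v - of_int (\<kappa> v)\<bar> < 1" for v
        using x True by (cases "v \<in> \<sigma>") auto
      then show "x \<in> lattice_nbhd K m \<kappa> \<inter> closed_simplex \<sigma>"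
        using x \<sigma> by (auto simp: lattice_nbhd_def polyhedron_of_def)
    qed (auto simp: lattice_nbhd_def)
    moreover have "open {x :: 'a \<Rightarrow> real. \<bar>real m * x v - of_int (\<kappa> v)\<bar> < 1}" for v
      by (intro open_Collect_less continuous_intros continuous_on_product_coordinates[THEN continuous_on_subset]) auto
    then have "open (\<Inter>v\<in>\<sigma>. {x :: 'a \<Rightarrow> real. \<bar>real m * x v - of_int (\<kappa> v)\<bar> < 1})"
      using assms[OF \<sigma>] by (intro open_INT) auto
    ultimately show ?thesis by (simp add: openin_open_Int)
  next
    case False
    then obtain v where v: "v \<notin> \<sigma>" "\<kappa> v \<noteq> 0" by blast
    have "lattice_nbhd K m \<kappa> \<inter> closed_simplex \<sigma> = {}"
    proof (rule equals0I)
      fix x assume "x \<in> lattice_nbhd K m \<kappa> \<inter> closed_simplex \<sigma>"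
      then have "\<bar>real m * x v - of_int (\<kappa> v)\<bar> < 1" and "x v = 0"
        using v(1) unfolding lattice_nbhd_def closed_simplex_def by blast+
      with v(2) show False by simp
    qed
    then show ?thesis by simp
  qed
qed (auto simp: lattice_nbhd_def)

text \<open>The nearest even integer is at distance at most 1, with equality only at odd integers.
  Odd labels thus have to catch only isolated points of an edge.\<close>

lemma exists_near_even:
  fixes r :: real
  shows "(\<exists>n::int. odd n \<and> r = of_int n) \<or> (\<exists>n::int. even n \<and> \<bar>r - of_int n\<bar> < 1)"
proof (cases "\<bar>r - of_int (2 * round (r / 2))\<bar> < 1")
  case False
  have "\<bar>r / 2 - of_int (round (r / 2))\<bar> \<le> 1 / 2"
    using of_int_round_abs_le[of "r / 2"] by (simp add: abs_minus_commute)
  then have "\<bar>r - of_int (2 * round (r / 2))\<bar> \<le> 1"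
    unfolding abs_le_iff of_int_mult of_int_numeral by linarith
  with False have "r = of_int (2 * round (r / 2) + 1) \<or> r = of_int (2 * round (r / 2) - 1)"
    by (auto simp: abs_if split: if_splits)
  then show ?thesis
    by (metis even_add even_diff even_mult_iff even_numeral odd_one)
qed (metis dvd_triv_left)

lemma polyhedron_1_cases:
  assumes K: "simplicial_complex_dim_le 1 K" and x: "x \<in> polyhedron_of K"
  obtains \<sigma> where "\<sigma> \<in> K" "x \<in> closed_simplex \<sigma>" "finite \<sigma>" "card \<sigma> = 1 \<or> card \<sigma> = 2"
proof -
  obtain \<sigma> where \<sigma>: "\<sigma> \<in> K" "x \<in> closed_simplex \<sigma>"
    using x by (auto simp: polyhedron_of_def)
  then have "finite \<sigma>" "\<sigma> \<noteq> {}" "card \<sigma> \<le> 2"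
    using K by (auto simp: simplicial_complex_dim_le_def)
  moreover have "card \<sigma> \<noteq> 0" using calculation by simp
  ultimately show ?thesis using that[OF \<sigma>] by linarith
qed

lemma lattice_nbhd_cover:
  assumes K: "simplicial_complex_dim_le 1 K" and x: "x \<in> polyhedron_of K"
  shows "\<exists>\<kappa>. (even_label \<kappa> \<or> odd_label \<kappa>) \<and> x \<in> lattice_nbhd K (2 * M) \<kappa>"
proof -
  obtain \<sigma> where \<sigma>: "\<sigma> \<in> K" "x \<in> closed_simplex \<sigma>" "finite \<sigma>" "card \<sigma> = 1 \<or> card \<sigma> = 2"
    using polyhedron_1_cases[OF assms] .
  have out: "x v = 0" if "v \<notin> \<sigma>" for v
    using \<sigma>(2) that by (auto simp: closed_simplex_def)
  have pos: "0 \<le> x v" for v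
    using \<sigma>(2) by (auto simp: closed_simplex_def)
  have sum: "sum x \<sigma> = 1"
    using \<sigma>(2) by (auto simp: closed_simplex_def)
  show ?thesis
    using \<sigma>(4)
  proof
    assume "card \<sigma> = 1"
    then obtain u where u: "\<sigma> = {u}" by (auto simp: card_1_singleton_iff)
    then have "x u = 1" using sum by simp
    then have "x \<in> lattice_nbhd K (2 * M) (\<lambda>v. if v = u then 2 * int M else 0)"
      using x out u by (auto simp: lattice_nbhd_def)
    moreover have "even_label (\<lambda>v. if v = u then 2 * int M else 0)"
      by (simp add: even_label_def)
    ultimately show ?thesis by blast
  next
    assume "card \<sigma> = 2"
    then obtain u w where uw: "\<sigma> = {u, w}" "u \<noteq> w" by (auto simp: card_2_iff)
    then have xw: "x w = 1 - x u" using sum by simp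
    \<comment> \<open>On the edge from \<open>u\<close> to \<open>w\<close> the two scaled
      coordinates add up to the even number \<open>2 * M\<close>. Hence the two entries of the label
      have the same parity, and the errors in the two coordinates are opposite.\<close>
    define \<kappa> where "\<kappa> = (\<lambda>n v. if v = u then n else if v = w then 2 * int M - n else 0)"
    have near: "x \<in> lattice_nbhd K (2 * M) (\<kappa> n)" if "\<bar>real (2 * M) * x u - of_int n\<bar> < 1" for n
    proof -
      have "real (2 * M) * x w - of_int (2 * int M - n) = - (real (2 * M) * x u - of_int n)"
        unfolding xw by (simp add: algebra_simps)
      then have "\<bar>real (2 * M) * x w - of_int (2 * int M - n)\<bar> < 1"
        using that by linarith
      with that show ?thesis
        using x out uw unfolding lattice_nbhd_def \<kappa>_def by auto
    qed
    from exists_near_even[of "real (2 * M) * x u"] show ?thesis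
    proof (elim disjE exE conjE)
      fix n :: int assume n: "odd n" "real (2 * M) * x u = of_int n"
      have "0 \<le> real (2 * M) * x u" "real (2 * M) * x u \<le> real (2 * M)"
        using pos[of u] pos[of w] xw by (auto intro: mult_left_le)
      then have "0 \<le> n" "n \<le> 2 * int M" 
        unfolding n(2) by linarith+
      moreover have "n \<noteq> 0" "n \<noteq> 2 * int M" using n(1) by auto
      ultimately have "odd_label (\<kappa> n)"
        unfolding odd_label_def \<kappa>_def using uw(2) n(1)
        by (intro exI[of _ u] exI[of _ w]) auto
      then show ?thesis
        using near[of n] n(2) by auto
    next
      fix n :: int assume n: "even n" "\<bar>real (2 * M) * x u - of_int n\<bar> < 1"
      have "even_label (\<kappa> n)"
        using n(1) by (simp add: even_label_def \<kappa>_def)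
      then show ?thesis using near[OF n(2)] by blast
    qed
  qed
qed

lemma lattice_nbhd_coordinates_close:
  assumes "x \<in> lattice_nbhd K m \<kappa>" "x \<in> lattice_nbhd K m \<kappa>'"
  shows "\<bar>\<kappa> v - \<kappa>' v\<bar> < 2"
proof -
  have "\<bar>real m * x v - of_int (\<kappa> v)\<bar> < 1" "\<bar>real m * x v - of_int (\<kappa>' v)\<bar> < 1"
    using assms by (auto simp: lattice_nbhd_def)
  then have "\<bar>real_of_int (\<kappa> v - \<kappa>' v)\<bar> < 2" by simp
  then show ?thesis by linarith
qed

text \<open>Labels at a common point differ by less than 2 in each coordinate, so equal parities
  force equality. For odd labels the two positive entries lie over the simplex of the point and fill
  it, so both labels are odd at the same two vertices and zero elsewhere.\<close>

lemma lattice_nbhd_disjoint: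
  assumes K: "simplicial_complex_dim_le 1 K"
    and x: "x \<in> lattice_nbhd K m \<kappa>" "x \<in> lattice_nbhd K m \<kappa>'"
    and type: "even_label \<kappa> \<and> even_label \<kappa>' \<or> odd_label \<kappa> \<and> odd_label \<kappa>'"
  shows "\<kappa> = \<kappa>'"
proof
  fix v
  have close: "\<bar>\<kappa> v - \<kappa>' v\<bar> < 2" for v
    using lattice_nbhd_coordinates_close[OF x] .
  have eqI: "\<kappa> v = \<kappa>' v" if "even (\<kappa> v - \<kappa>' v)" for v
    using close[of v] that by presburger
  from type show "\<kappa> v = \<kappa>' v"
  proof
    assume "even_label \<kappa> \<and> even_label \<kappa>'"
    then show ?thesis by (intro eqI) (simp add: even_label_def)
  next
    assume odd: "odd_label \<kappa> \<and> odd_label \<kappa>'"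
    obtain \<sigma> where \<sigma>: "x \<in> closed_simplex \<sigma>" "finite \<sigma>" "card \<sigma> = 1 \<or> card \<sigma> = 2"
      using polyhedron_1_cases[OF K, of x] x(1) by (auto simp: lattice_nbhd_def)
    have edge: "(v \<in> \<sigma> \<longrightarrow> odd (\<mu> v)) \<and> (v \<notin> \<sigma> \<longrightarrow> \<mu> v = 0)"
      if \<mu>: "odd_label \<mu>" "x \<in> lattice_nbhd K m \<mu>" for \<mu> v
    proof -
      obtain u w where uw: "u \<noteq> w" "odd (\<mu> u)" "odd (\<mu> w)" "0 < \<mu> u" "0 < \<mu> w"
        "\<And>v. v \<noteq> u \<Longrightarrow> v \<noteq> w \<Longrightarrow> \<mu> v = 0"
        using \<mu>(1) by (auto simp: odd_label_def)
      have "v \<in> \<sigma>" if "0 < \<mu> v" for v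
      proof (rule ccontr)
        assume "v \<notin> \<sigma>"
        then have "x v = 0" using \<sigma>(1) by (auto simp: closed_simplex_def)
        moreover have "\<bar>real m * x v - of_int (\<mu> v)\<bar> < 1"
          using \<mu>(2) by (auto simp: lattice_nbhd_def)
        ultimately show False using that by simp
      qed
      then have "{u, w} \<subseteq> \<sigma>" using uw by auto
      moreover have "card {u, w} = 2" using uw(1) by simp
      ultimately have "\<sigma> = {u, w}"
        using \<sigma>(2,3) card_mono[of \<sigma> "{u, w}"] card_subset_eq[of \<sigma> "{u, w}"] by auto
      then show ?thesis using uw by auto
    qed
    show ?thesis
      using edge[of \<kappa> v] edge[of \<kappa>' v] odd x by (cases "v \<in> \<sigma>") (auto intro: eqI)
  qed
qed

section \<open>Compactness\<close>

text \<open>Otherwise there are pairs with \<open>D p q\<close> at least \<open>R\<close> and images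
  ever closer in every coordinate; a limit pair has equal images and still \<open>D\<close> at least
  \<open>R\<close>. The functions \<open>f\<close> and \<open>g\<close> are the localizing map on
  two squares, and the form \<open>eventually\<close> lets finitely many pairs of squares share one
  \<open>n\<close>.\<close>

lemma eventually_separated:
  fixes f g :: "'a::metric_space \<Rightarrow> 'k \<Rightarrow> real" and D :: "'a \<Rightarrow> 'a \<Rightarrow> real"
  assumes S: "compact S" and f: "\<And>v. continuous_on S (\<lambda>p. f p v)" and g: "\<And>v. continuous_on S (\<lambda>p. g p v)"
    and D: "continuous_on (S \<times> S) (\<lambda>(p, q). D p q)"
    and fib: "\<And>p q. p \<in> S \<Longrightarrow> q \<in> S \<Longrightarrow> f p = g q \<Longrightarrow> D p q < R"
  shows "eventually (\<lambda>n. \<forall>p\<in>S. \<forall>q\<in>S. (\<forall>v. real n * \<bar>f p v - g q v\<bar> < 1) \<longrightarrow> D p q < R) sequentially"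
proof (rule ccontr)
  assume "\<not> ?thesis"
  then have "\<forall>N. \<exists>n\<ge>N. \<exists>p\<in>S. \<exists>q\<in>S. (\<forall>v. real n * \<bar>f p v - g q v\<bar> < 1) \<and> R \<le> D p q"
    unfolding eventually_sequentially by (meson not_le)
  then obtain \<nu> p q where \<nu>: "\<And>N. \<nu> N \<ge> N" and pq: "\<And>N. p N \<in> S" "\<And>N. q N \<in> S"
    and small: "\<And>N v. real (\<nu> N) * \<bar>f (p N) v - g (q N) v\<bar> < 1" and big: "\<And>N. R \<le> D (p N) (q N)"
    by metis
  have "compact (S \<times> S)" using S by (intro compact_Times)
  moreover have "\<forall>N. (p N, q N) \<in> S \<times> S" using pq by simp
  ultimately obtain l r where l: "l \<in> S \<times> S" and r: "strict_mono r"
    and lim: "((\<lambda>N. (p N, q N)) \<circ> r) \<longlonglongrightarrow> l"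
    unfolding compact_def by (metis (no_types, lifting))
  obtain a b where [simp]: "l = (a, b)" by (cases l)
  have ab: "a \<in> S" "b \<in> S" using l by auto
  have pa: "(\<lambda>N. p (r N)) \<longlonglongrightarrow> a" and qb: "(\<lambda>N. q (r N)) \<longlonglongrightarrow> b"
    using tendsto_fst[OF lim] tendsto_snd[OF lim] by (simp_all add: o_def)
  have "f a v = g b v" for v
  proof -
    have "(\<lambda>N. f (p (r N)) v) \<longlonglongrightarrow> f a v"
      by (rule continuous_on_tendsto_compose[OF f pa ab(1)]) (simp add: pq)
    moreover have "(\<lambda>N. g (q (r N)) v) \<longlonglongrightarrow> g b v"
      by (rule continuous_on_tendsto_compose[OF g qb ab(2)]) (simp add: pq)
    ultimately have "(\<lambda>N. f (p (r N)) v - g (q (r N)) v) \<longlonglongrightarrow> f a v - g b v"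
      by (rule tendsto_diff)
    moreover have "(\<lambda>N. f (p (r N)) v - g (q (r N)) v) \<longlonglongrightarrow> 0"
    proof (rule Lim_null_comparison)
      have "norm (f (p (r N)) v - g (q (r N)) v) \<le> 1 / real N" if "N \<ge> 1" for N
      proof -
        have "N \<le> \<nu> (r N)" using \<nu>[of "r N"] seq_suble[OF r, of N] by simp
        then have "real N * \<bar>f (p (r N)) v - g (q (r N)) v\<bar> \<le> real (\<nu> (r N)) * \<bar>f (p (r N)) v - g (q (r N)) v\<bar>"
          by (intro mult_right_mono) auto
        also have "\<dots> \<le> 1" using small[of "r N" v] by simp
        finally show ?thesis using that by (simp add: field_simps)
      qed
      then show "\<forall>\<^sub>F N in sequentially. norm (f (p (r N)) v - g (q (r N)) v) \<le> 1 / real N"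
        by (intro eventually_sequentiallyI[of 1])
      show "(\<lambda>N. 1 / real N) \<longlonglongrightarrow> 0" by (rule lim_1_over_n)
    qed
    ultimately show ?thesis using LIMSEQ_unique by fastforce
  qed
  then have "D a b < R" using fib ab by blast
  moreover have "(\<lambda>N. D (p (r N)) (q (r N))) \<longlonglongrightarrow> D a b"
    using continuous_on_tendsto_compose[OF D lim l] pq by (simp add: o_def)
  then have "R \<le> D a b"
    by (rule LIMSEQ_le_const) (use big in blast)
  ultimately show False by simp
qed

text \<open>The Lebesgue number lemma: a cell of the grid has diameter at most \<open>2 / n\<close>.
  The form \<open>eventually\<close> again allows one \<open>n\<close> for all squares.\<close>

lemma eventually_grid_subordinate:
  fixes \<C> :: "(real \<times> real) set set"
  assumes "\<And>B. B \<in> \<C> \<Longrightarrow> openin (top_of_set ({0..1} \<times> {0..1})) B" and "{0..1} \<times> {0..1} \<subseteq> \<Union>\<C>"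
  shows "eventually (\<lambda>n. \<forall>k<n. \<forall>l<n. \<exists>B\<in>\<C>.
    {real k / real n..real (Suc k) / real n} \<times> {real l / real n..real (Suc l) / real n} \<subseteq> B) sequentially"
proof -
  let ?S = "{0..1} \<times> {0..1} :: (real \<times> real) set"
  define \<D> where "\<D> = {U. open U \<and> (\<exists>B\<in>\<C>. ?S \<inter> U \<subseteq> B)}"
  have cover: "?S \<subseteq> \<Union>\<D>"
  proof
    fix x assume "x \<in> ?S"
    then obtain B where "B \<in> \<C>" "x \<in> B" using assms(2) by blast
    moreover obtain U where "open U" "B = ?S \<inter> U"
      using assms(1)[OF \<open>B \<in> \<C>\<close>] by (auto simp: openin_open)
    ultimately show "x \<in> \<Union>\<D>" unfolding \<D>_def by blast
  qed
  have ne: "\<D> \<noteq> {}" using cover by fastforce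
  have cpt: "compact ?S" by (intro compact_Times compact_Icc)
  obtain \<delta> where \<delta>: "0 < \<delta>" "\<And>T. T \<subseteq> ?S \<Longrightarrow> diameter T < \<delta> \<Longrightarrow> \<exists>B\<in>\<D>. T \<subseteq> B"
    using Lebesgue_number_lemma[OF cpt ne cover] unfolding \<D>_def by blast
  have "eventually (\<lambda>n. 2 / real n < \<delta>) sequentially"
    by (rule order_tendstoD(2)[OF lim_const_over_n \<delta>(1)])
  moreover have "eventually (\<lambda>n. n > (0::nat)) sequentially"
    by (rule eventually_gt_at_top)
  ultimately show ?thesis
  proof eventually_elim
    case (elim n)
    show ?case
    proof (intro allI impI)
      fix k l assume kl: "k < n" "l < n"
      let ?T = "{real k / real n..real (Suc k) / real n} \<times> {real l / real n..real (Suc l) / real n}"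
      have unit: "{real j / real n..real (Suc j) / real n} \<subseteq> {0..1}" if "j < n" for j
        using that by (auto simp: field_simps intro: order_trans)
      have "?T \<subseteq> ?S" using unit kl by blast
      moreover have "diameter ?T \<le> 2 / real n"
      proof (rule diameter_le)
        fix x y assume xy: "x \<in> ?T" "y \<in> ?T"
        have "\<bar>s - t\<bar> \<le> 1 / real n"
          if "s \<in> {real j / real n..real (Suc j) / real n}" "t \<in> {real j / real n..real (Suc j) / real n}" for s t j
        proof -
          have "real (Suc j) / real n = real j / real n + 1 / real n" by (simp add: add_divide_distrib)
          then show ?thesis using that by (auto simp: abs_le_iff)
        qed
        then have "\<bar>fst x - fst y\<bar> \<le> 1 / real n" "\<bar>snd x - snd y\<bar> \<le> 1 / real n"
          using xy by (auto simp: mem_Times_iff)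
        moreover have "norm (x - y) \<le> \<bar>fst x - fst y\<bar> + \<bar>snd x - snd y\<bar>"
          using sqrt_sum_squares_le_sum_abs[of "fst x - fst y" "snd x - snd y"]
          by (simp add: norm_prod_def)
        ultimately show "norm (x - y) \<le> 2 / real n" by simp
      qed simp
      then have "diameter ?T < \<delta>" using elim by simp
      ultimately obtain U where "U \<in> \<D>" "?T \<subseteq> U" using \<delta>(2) by blast
      then obtain B where "B \<in> \<C>" "?S \<inter> U \<subseteq> B" by (auto simp: \<D>_def)
      then have "?T \<subseteq> B" using \<open>?T \<subseteq> ?S\<close> \<open>?T \<subseteq> U\<close> by blast
      with \<open>B \<in> \<C>\<close> show "\<exists>B\<in>\<C>. ?T \<subseteq> B" by blast
    qed
  qed
qed

section \<open>The square complex\<close>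

abbreviation square_complex :: "('v, 'e) pre_digraph \<Rightarrow> (('v, 'e) graph_point \<times> ('v, 'e) graph_point) metrized_complex" where
  "square_complex G \<equiv> product_complex (graph_complex G) (graph_complex G)"

definition square_map :: "('v, 'e) pre_digraph \<Rightarrow> 'e \<times> 'e \<Rightarrow> real \<times> real \<Rightarrow>
    ('v, 'e) graph_point \<times> ('v, 'e) graph_point" where
  "square_map G a p = (edge_map G (fst a) (fst p), edge_map G (snd a) (snd p))"

definition good_squares :: "('v, 'e) pre_digraph \<Rightarrow> (('v, 'e) graph_point \<times> ('v, 'e) graph_point) set set \<Rightarrow> ('e \<times> 'e) set" where
  "good_squares G S = {(e, e') \<in> arcs G \<times> arcs G. \<forall>v\<in>{tail G e, head G e}. \<forall>w\<in>{tail G e', head G e'}.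
     {(Vertex v, Vertex w)} \<notin> S}"

text \<open>The cell of the graph containing \<open>edge_map G e t\<close>; it is used to find the
  product cell in which a point of a closed square lies.\<close>

definition open_cell :: "('v, 'e) pre_digraph \<Rightarrow> 'e \<Rightarrow> real \<Rightarrow> ('v, 'e) graph_point set" where
  "open_cell G e t = (if t = 0 then {Vertex (tail G e)} else if t = 1 then {Vertex (head G e)}
     else edge_map G e ` {0<..<1})"

definition grid_square :: "nat \<Rightarrow> nat \<Rightarrow> nat \<Rightarrow> (real \<times> real) set" where
  "grid_square n k l = {real k / real n..real (Suc k) / real n} \<times> {real l / real n..real (Suc l) / real n}"

lemma points_square_complex: "points (square_complex G) = graph_points G \<times> graph_points G"
  and pdist_square_complex: "pdist (square_complex G) = prod_dist (path_metric G) (path_metric G)"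
  by (simp_all add: product_complex_def graph_complex_def)

lemma edge_map_in_open_cell: "t \<in> {0..1} \<Longrightarrow> edge_map G e t \<in> open_cell G e t"
  by (auto simp: open_cell_def)

lemma open_cell_subset: "t \<in> {0..1} \<Longrightarrow> open_cell G e t \<subseteq> edge_map G e ` {0..1}"
  by (auto simp: open_cell_def intro: image_eqI[of _ _ 0] image_eqI[of _ _ 1])

lemma open_cell_in_cells:
  assumes "wf_digraph G" "e \<in> arcs G"
  shows "\<exists>i. open_cell G e t \<in> cells (graph_complex G) i"
proof -
  have "tail G e \<in> verts G" "head G e \<in> verts G"
    using assms by (auto intro: wf_digraph.tail_in_verts wf_digraph.head_in_verts)
  then have "open_cell G e t \<in> cells (graph_complex G) 0 \<or> open_cell G e t \<in> cells (graph_complex G) 1"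
    using assms(2) by (auto simp: open_cell_def graph_complex_def)
  then show ?thesis by blast
qed

lemma cells_square_complex_0:
  "cells (square_complex G) 0 = (\<lambda>(v, w). {(Vertex v, Vertex w)}) ` (verts G \<times> verts G)"
  by (auto simp: product_complex_def graph_complex_def image_iff)

lemma card_cells_square_complex_0: "card (cells (square_complex G) 0) = (card (verts G))\<^sup>2"
  unfolding cells_square_complex_0
  by (subst card_image) (auto simp: inj_on_def card_cartesian_product power2_eq_square)

lemma cell_subset_points:
  assumes "wf_digraph G" "c \<in> cells (square_complex G) k"
  shows "c \<subseteq> graph_points G \<times> graph_points G"
proof -
  have "a \<subseteq> graph_points G" if "a \<in> cells (graph_complex G) i" for a i
    using that edge_map_in_graph_points[of _ G]
    by (auto simp: graph_complex_def split: if_splits) (auto simp: graph_points_def)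
  with assms(2) show ?thesis
    by (auto simp: product_complex_def)
qed

text \<open>A bad square has a removed corner \<open>(v, w)\<close>; its first edge is one of at
  most \<open>d\<close> edges at \<open>v\<close>, its second one of at most \<open>d\<close> edges
  at \<open>w\<close>.\<close>

lemma card_bad_squares:
  fixes G :: "('v, 'e) pre_digraph"
  assumes G: "fin_digraph G" and reg: "regular_graph d G"
    and S: "finite S" "S \<subseteq> cells (square_complex G) 0"
  shows "card (arcs G \<times> arcs G - good_squares G S) \<le> card S * d\<^sup>2"
proof -
  interpret fin_digraph G by (rule G)
  define inc where "inc = (\<lambda>v. {e \<in> arcs G. tail G e = v \<or> head G e = v})"
  define corner :: "(('v, 'e) graph_point \<times> ('v, 'e) graph_point) set \<Rightarrow> 'v \<times> 'v"
    where "corner = (\<lambda>s. SOME p. p \<in> verts G \<times> verts G \<and> s = {(Vertex (fst p), Vertex (snd p))})"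
  have corner: "corner s \<in> verts G \<times> verts G" "s = {(Vertex (fst (corner s)), Vertex (snd (corner s)))}"
    if "s \<in> S" for s
  proof -
    have "\<exists>p. p \<in> verts G \<times> verts G \<and> s = {(Vertex (fst p), Vertex (snd p))}"
      using S(2) that unfolding cells_square_complex_0 by fastforce
    from someI_ex[OF this] show "corner s \<in> verts G \<times> verts G"
        "s = {(Vertex (fst (corner s)), Vertex (snd (corner s)))}"
      unfolding corner_def by blast+
  qed
  have "arcs G \<times> arcs G - good_squares G S \<subseteq> (\<Union>s\<in>S. inc (fst (corner s)) \<times> inc (snd (corner s)))"
  proof
    fix a assume a: "a \<in> arcs G \<times> arcs G - good_squares G S"
    then have "\<exists>v\<in>{tail G (fst a), head G (fst a)}. \<exists>w\<in>{tail G (snd a), head G (snd a)}. {(Vertex v, Vertex w)} \<in> S"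
      by (cases a) (simp add: good_squares_def)
    then obtain v w where vw: "v \<in> {tail G (fst a), head G (fst a)}" "w \<in> {tail G (snd a), head G (snd a)}"
      "{(Vertex v, Vertex w)} \<in> S"
      by blast
    from corner(2)[OF vw(3)] have "fst (corner {(Vertex v, Vertex w)}) = v" "snd (corner {(Vertex v, Vertex w)}) = w"
      by auto
    then have "a \<in> inc (fst (corner {(Vertex v, Vertex w)})) \<times> inc (snd (corner {(Vertex v, Vertex w)}))"
      using a vw by (auto simp: inc_def mem_Times_iff)
    with vw(3) show "a \<in> (\<Union>s\<in>S. inc (fst (corner s)) \<times> inc (snd (corner s)))" by blast
  qed
  then have "card (arcs G \<times> arcs G - good_squares G S) \<le> card (\<Union>s\<in>S. inc (fst (corner s)) \<times> inc (snd (corner s)))"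
    using S(1) by (intro card_mono) (auto simp: inc_def)
  also have "\<dots> \<le> (\<Sum>s\<in>S. card (inc (fst (corner s)) \<times> inc (snd (corner s))))"
    by (rule card_UN_le[OF S(1)])
  also have "\<dots> \<le> (\<Sum>s\<in>S. d\<^sup>2)"
  proof (rule sum_mono)
    fix s assume "s \<in> S"
    then have "card (inc (fst (corner s))) \<le> d" "card (inc (snd (corner s))) \<le> d"
      using corner(1)[of s] regular_graph_card_incident[OF reg] by (auto simp: inc_def mem_Times_iff)
    then show "card (inc (fst (corner s)) \<times> inc (snd (corner s))) \<le> d\<^sup>2"
      by (simp add: card_cartesian_product power2_eq_square mult_mono)
  qed
  finally show ?thesis by simp
qed

section \<open>Closed squares inside the remainder\<close>

context
  fixes G :: "('v, 'e) pre_digraph"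
  assumes G: "fin_digraph G" and conn: "Digraph_Component.connected G"
begin

interpretation fin_digraph G by (rule G)

interpretation PP: Metric_space "graph_points G \<times> graph_points G" "prod_dist (path_metric G) (path_metric G)"
  by (rule Metric_space_product[OF G conn])

text \<open>The distance from \<open>v\<close> is at least 1 at both ends of the edge, hence all
  along it. So the closure of an edge contains no vertices but its ends.\<close>

lemma path_metric_vertex_ge_1:
  assumes v: "v \<in> verts G" and e: "e \<in> arcs G" and t: "t \<in> {0..1}" and "v \<noteq> tail G e" "v \<noteq> head G e"
  shows "1 \<le> path_metric G (Vertex v) (edge_map G e t)"
proof -
  have pos: "1 \<le> graph_dist G v x" if "x \<in> verts G" "v \<noteq> x" for x
    using graph_dist_eq_0[OF G conn v that(1)] that(2) by (metis less_one not_le)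
  have "1 \<le> graph_dist G v (tail G e)" "1 \<le> graph_dist G v (head G e)"
    using pos assms by auto
  then have "1 \<le> real (graph_dist G v (tail G e))" "1 \<le> real (graph_dist G v (head G e))"
    by linarith+
  then have "1 \<le> vertex_dist G v (edge_map G e t)"
    unfolding vertex_dist_edge_map[OF G conn v e t] using t by auto
  moreover have "vertex_dist G v (Vertex v) = 0"
    by (simp add: vertex_dist_def graph_dist_self[OF G conn])
  moreover have "Vertex v \<in> graph_points G" using v by (simp add: graph_points_def)
  ultimately show ?thesis
    using path_metric_lipschitz[OF G conn vertex_dist_lipschitz[OF G conn v], of "Vertex v" "edge_map G e t"]
      edge_map_in_graph_points[OF e t] by linarith
qed

lemma vertex_pair_in_closure:
  assumes e: "e \<in> arcs G" "e' \<in> arcs G" and A: "A \<subseteq> edge_map G e ` {0..1}" "B \<subseteq> edge_map G e' ` {0..1}"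
    and vw: "v \<in> verts G" "w \<in> verts G"
    and cl: "(Vertex v, Vertex w) \<in> PP.mtopology closure_of (A \<times> B)"
  shows "v \<in> {tail G e, head G e} \<and> w \<in> {tail G e', head G e'}"
proof -
  have "\<exists>p\<in>A \<times> B. p \<in> PP.mball (Vertex v, Vertex w) 1"
    using cl unfolding PP.metric_closure_of by fastforce
  then obtain s t where st: "s \<in> {0..1}" "t \<in> {0..1}"
    and less: "prod_dist (path_metric G) (path_metric G) (Vertex v, Vertex w) (edge_map G e s, edge_map G e' t) < 1"
    using A by (auto simp: subset_iff image_iff; metis atLeastAtMost_iff)
  have "(path_metric G (Vertex v) (edge_map G e s))\<^sup>2 + (path_metric G (Vertex w) (edge_map G e' t))\<^sup>2 < 1"
    using less by (simp add: prod_dist_def)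
  then have "(path_metric G (Vertex v) (edge_map G e s))\<^sup>2 < 1" "(path_metric G (Vertex w) (edge_map G e' t))\<^sup>2 < 1"
    using zero_le_power2[of "path_metric G (Vertex v) (edge_map G e s)"]
      zero_le_power2[of "path_metric G (Vertex w) (edge_map G e' t)"] by linarith+
  then have "\<bar>path_metric G (Vertex v) (edge_map G e s)\<bar> < 1" "\<bar>path_metric G (Vertex w) (edge_map G e' t)\<bar> < 1"
    by (simp_all add: abs_square_less_1)
  then show ?thesis
    using path_metric_vertex_ge_1[OF vw(1) e(1) st(1)] path_metric_vertex_ge_1[OF vw(2) e(2) st(2)] by force
qed

text \<open>A point of a closed good square lies in a product of open cells of its two edges, and
  the only 0-cells in the closure of that product are corners of the square, none of which is
  removed.\<close>

lemma square_map_in_points: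
  assumes "S \<subseteq> cells (square_complex G) 0" "a \<in> good_squares G S" "p \<in> {0..1} \<times> {0..1}"
  shows "square_map G a p \<in> points (remove_0_cells (square_complex G) S)"
proof -
  obtain e e' s t where ap: "a = (e, e')" "p = (s, t)" by (cases a, cases p)
  have e: "e \<in> arcs G" "e' \<in> arcs G" and st: "s \<in> {0..1}" "t \<in> {0..1}"
    using assms ap by (auto simp: good_squares_def)
  let ?c = "open_cell G e s \<times> open_cell G e' t"
  obtain i j where "open_cell G e s \<in> cells (graph_complex G) i" "open_cell G e' t \<in> cells (graph_complex G) j"
    using open_cell_in_cells[OF wf_digraph] e by metis
  then have "?c \<in> cells (square_complex G) (i + j)"
    by (auto simp: product_complex_def)
  moreover have "\<not> z \<subseteq> complex_topology (square_complex G) closure_of ?c" if "z \<in> S" for z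
  proof
    assume z: "z \<subseteq> complex_topology (square_complex G) closure_of ?c"
    obtain v w where vw: "v \<in> verts G" "w \<in> verts G" "z = {(Vertex v, Vertex w)}"
      using assms(1) \<open>z \<in> S\<close> unfolding cells_square_complex_0 by blast
    then have "(Vertex v, Vertex w) \<in> PP.mtopology closure_of ?c"
      using z by (simp add: complex_topology_def points_square_complex pdist_square_complex)
    from vertex_pair_in_closure[OF e open_cell_subset[OF st(1)] open_cell_subset[OF st(2)] vw(1,2) this]
    show False using assms(2) that vw(3) ap by (auto simp: good_squares_def)
  qed
  ultimately have cell: "?c \<in> surviving_cells (square_complex G) S (i + j)"
    by (auto simp: surviving_cells_def)
  have mem: "square_map G a p \<in> ?c"
    using edge_map_in_open_cell[OF st(1), of G e] edge_map_in_open_cell[OF st(2), of G e']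
    by (simp add: square_map_def ap)
  have "square_map G a p \<in> (\<Union>k. \<Union>(surviving_cells (square_complex G) S k))"
    by (rule UN_I[of "i + j"]) (rule UNIV_I, rule UnionI[OF cell mem])
  then show ?thesis
    by (simp add: remove_0_cells_def)
qed

lemma points_remove_subset:
  "points (remove_0_cells (square_complex G) S) \<subseteq> graph_points G \<times> graph_points G"
  using cell_subset_points[OF wf_digraph] by (fastforce simp: remove_0_cells_def surviving_cells_def)

section \<open>Continuity on closed squares\<close>

lemma pdist_square_map_le:
  assumes "a \<in> arcs G \<times> arcs G" "p \<in> {0..1} \<times> {0..1}" "q \<in> {0..1} \<times> {0..1}"
  shows "prod_dist (path_metric G) (path_metric G) (square_map G a p) (square_map G a q) \<le> 2 * dist p q"
proof -
  let ?x = "path_metric G (edge_map G (fst a) (fst p)) (edge_map G (fst a) (fst q))"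
  let ?y = "path_metric G (edge_map G (snd a) (snd p)) (edge_map G (snd a) (snd q))"
  have "?x \<le> \<bar>fst p - fst q\<bar>" "?y \<le> \<bar>snd p - snd q\<bar>"
    using assms by (auto intro!: path_metric_edge_le)
  moreover have "0 \<le> ?x" "0 \<le> ?y"
    using assms by (auto intro!: path_metric_nonneg[OF G conn] edge_map_in_graph_points)
  moreover have "sqrt (?x\<^sup>2 + ?y\<^sup>2) \<le> ?x + ?y"
    using \<open>0 \<le> ?x\<close> \<open>0 \<le> ?y\<close> by (rule sqrt_sum_squares_le_sum)
  moreover have "\<bar>fst p - fst q\<bar> \<le> dist p q" "\<bar>snd p - snd q\<bar> \<le> dist p q"
    using dist_fst_le[of p q] dist_snd_le[of p q] by (simp_all add: dist_real_def)
  ultimately show ?thesis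
    by (simp add: prod_dist_def square_map_def)
qed

lemma square_map_in_graph_points:
  "a \<in> arcs G \<times> arcs G \<Longrightarrow> p \<in> {0..1} \<times> {0..1} \<Longrightarrow> square_map G a p \<in> graph_points G \<times> graph_points G"
  by (auto simp: square_map_def intro: edge_map_in_graph_points)

lemma continuous_on_pdist_square_map:
  assumes a: "a \<in> arcs G \<times> arcs G" and b: "b \<in> arcs G \<times> arcs G"
  shows "continuous_on (({0..1} \<times> {0..1}) \<times> ({0..1} \<times> {0..1}))
    (\<lambda>(p, q). prod_dist (path_metric G) (path_metric G) (square_map G a p) (square_map G b q))"
    (is "continuous_on (?S \<times> ?S) (\<lambda>(p, q). ?D p q)")
proof -
  let ?d = "prod_dist (path_metric G) (path_metric G)"
  have "4-lipschitz_on (?S \<times> ?S) (\<lambda>(p, q). ?D p q)"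
  proof (rule lipschitz_onI)
    fix x y assume x: "x \<in> ?S \<times> ?S" and y: "y \<in> ?S \<times> ?S"
    note in_pts = square_map_in_graph_points[OF a, of "fst x"] square_map_in_graph_points[OF a, of "fst y"]
      square_map_in_graph_points[OF b, of "snd x"] square_map_in_graph_points[OF b, of "snd y"]
    have mem: "fst x \<in> ?S" "fst y \<in> ?S" "snd x \<in> ?S" "snd y \<in> ?S"
      using x y by (auto simp: mem_Times_iff)
    have le: "?d (square_map G a (fst x)) (square_map G a (fst y)) \<le> 2 * dist (fst x) (fst y)"
      "?d (square_map G b (snd x)) (square_map G b (snd y)) \<le> 2 * dist (snd x) (snd y)"
      by (rule pdist_square_map_le[OF a mem(1,2)], rule pdist_square_map_le[OF b mem(3,4)])
    have "\<bar>?D (fst x) (snd x) - ?D (fst y) (snd y)\<bar> \<le>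
        ?d (square_map G a (fst x)) (square_map G a (fst y)) + ?d (square_map G b (snd x)) (square_map G b (snd y))"
      using PP.triangle[OF in_pts(1) in_pts(2) in_pts(3), OF mem(1,2,3)]
        PP.triangle[OF in_pts(2) in_pts(4) in_pts(3), OF mem(2,4,3)]
        PP.triangle[OF in_pts(2) in_pts(1) in_pts(4), OF mem(2,1,4)]
        PP.triangle[OF in_pts(1) in_pts(3) in_pts(4), OF mem(1,3,4)]
        PP.commute[of "square_map G a (fst x)" "square_map G a (fst y)"]
        PP.commute[of "square_map G b (snd x)" "square_map G b (snd y)"]
      by linarith
    also have "\<dots> \<le> 4 * dist x y"
      using le dist_fst_le[of x y] dist_snd_le[of x y] by linarith
    finally show "dist (case x of (p, q) \<Rightarrow> ?D p q) (case y of (p, q) \<Rightarrow> ?D p q) \<le> 4 * dist x y"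
      by (simp add: dist_real_def case_prod_unfold)
  qed simp
  then show ?thesis by (rule lipschitz_on_continuous_on)
qed

lemma continuous_map_square_map:
  assumes S: "S \<subseteq> cells (square_complex G) 0" and a: "a \<in> good_squares G S"
  shows "continuous_map (top_of_set ({0..1} \<times> {0..1}))
    (complex_topology (remove_0_cells (square_complex G) S)) (square_map G a)"
proof -
  let ?Y = "remove_0_cells (square_complex G) S"
  have pdist: "pdist ?Y = prod_dist (path_metric G) (path_metric G)"
    by (simp add: remove_0_cells_def pdist_square_complex)
  interpret Y: Metric_space "points ?Y" "prod_dist (path_metric G) (path_metric G)"
    by (rule PP.subspace[OF points_remove_subset])
  have aG: "a \<in> arcs G \<times> arcs G" using a by (auto simp: good_squares_def)
  show ?thesis
    unfolding complex_topology_def pdist Y.continuous_map_to_metric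
  proof (intro ballI allI impI)
    fix p and \<epsilon> :: real assume "p \<in> topspace (top_of_set ({0..1::real} \<times> {0..1::real}))" "0 < \<epsilon>"
    then have p: "p \<in> {0..1} \<times> {0..1}" by simp
    show "\<exists>U. openin (top_of_set ({0..1} \<times> {0..1})) U \<and> p \<in> U \<and>
        (\<forall>q\<in>U. square_map G a q \<in> Y.mball (square_map G a p) \<epsilon>)"
    proof (intro exI[of _ "({0..1} \<times> {0..1}) \<inter> ball p (\<epsilon> / 2)"] conjI ballI)
      fix q assume q: "q \<in> ({0..1} \<times> {0..1}) \<inter> ball p (\<epsilon> / 2)"
      then have "prod_dist (path_metric G) (path_metric G) (square_map G a p) (square_map G a q) < \<epsilon>"
        using pdist_square_map_le[OF aG p, of q] by auto
      then show "square_map G a q \<in> Y.mball (square_map G a p) \<epsilon>"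
        using square_map_in_points[OF S a] p q by simp
    qed (use p \<open>0 < \<epsilon>\<close> in \<open>auto simp: openin_open_Int\<close>)
  qed
qed

lemma finite_good_squares: "finite (good_squares G S)"
  by (rule finite_subset[of _ "arcs G \<times> arcs G"]) (auto simp: good_squares_def)

text \<open>The passage from topology to combinatorics. Sets with labels of the same type are
  disjoint, each set is small in the metric of the original complex, and each closed grid cell fits
  into one set. As \<open>Z\<close> is a finite union of closed squares, compactness provides one
  scale for the target and one grid size for all squares.\<close>

lemma localizable_grid_labelling:
  fixes S and R :: real
  defines "Z \<equiv> (\<Union>a\<in>good_squares G S. square_map G a ` ({0..1} \<times> {0..1}))"
  assumes S: "S \<subseteq> cells (square_complex G) 0"
    and loc: "localizable TYPE('k) 1 R (remove_0_cells (square_complex G) S)"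
  shows "\<exists>n (L :: ('k \<Rightarrow> int) set) (ty :: _ \<Rightarrow> bool) W. 0 < n \<and>
    (\<forall>l\<in>L. \<forall>l'\<in>L. ty l = ty l' \<longrightarrow> W l \<inter> W l' \<noteq> {} \<longrightarrow> l = l') \<and>
    (\<forall>l\<in>L. \<forall>x\<in>W l. \<forall>y\<in>W l. prod_dist (path_metric G) (path_metric G) x y < R) \<and>
    (\<forall>a\<in>good_squares G S. \<forall>i<n. \<forall>j<n. \<exists>l\<in>L. square_map G a ` grid_square n i j \<subseteq> W l)"
proof -
  let ?Y = "remove_0_cells (square_complex G) S" and ?Q = "good_squares G S"
  let ?d = "prod_dist (path_metric G) (path_metric G)"
  let ?S = "{0..1} \<times> {0..1} :: (real \<times> real) set"
  have pdist: "pdist ?Y = ?d"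
    by (simp add: remove_0_cells_def pdist_square_complex)
  obtain K :: "'k set set" and f where K: "simplicial_complex_dim_le 1 K"
    and f: "continuous_map (complex_topology ?Y) (polyhedron_topology K) f"
    and fib: "\<And>q. q \<in> polyhedron_of K \<Longrightarrow> diameter_in ?Y {y \<in> points ?Y. f y = q} < ennreal R"
    using loc unfolding localizable_def by blast
  have finK: "\<And>\<sigma>. \<sigma> \<in> K \<Longrightarrow> finite \<sigma>"
    using K by (auto simp: simplicial_complex_dim_le_def)
  have cont: "continuous_map (top_of_set ?S) (polyhedron_topology K) (f \<circ> square_map G a)" if "a \<in> ?Q" for a
    using continuous_map_compose[OF continuous_map_square_map[OF S that] f] .
  have in_K: "f (square_map G a p) \<in> polyhedron_of K" if "a \<in> ?Q" "p \<in> ?S" for a p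
    using continuous_map_image_subset_topspace[OF cont[OF that(1)]] that(2) by auto
  have coord: "continuous_on ?S (\<lambda>p. f (square_map G a p) v)" if "a \<in> ?Q" for a v
    using continuous_map_compose[OF cont[OF that] continuous_map_barycentric_coordinate[of K v]]
    by (simp add: o_def)
  have fibre: "?d (square_map G a p) (square_map G b q) < R"
    if "a \<in> ?Q" "b \<in> ?Q" "p \<in> ?S" "q \<in> ?S" "f (square_map G a p) = f (square_map G b q)" for a b p q
  proof -
    let ?F = "{y \<in> points ?Y. f y = f (square_map G b q)}"
    have "(square_map G a p, square_map G b q) \<in> ?F \<times> ?F"
      using that square_map_in_points[OF S] by simp
    then have "ennreal (?d (square_map G a p) (square_map G b q)) \<le> diameter_in ?Y ?F"
      unfolding diameter_in_def pdist by (rule SUP_upper2) simp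
    also have "\<dots> < ennreal R" by (rule fib[OF in_K[OF that(2,4)]])
    \<comment> \<open>Nonnegativity of the product metric is what makes the comparison in
      \<open>ennreal\<close>, which truncates negative reals, a comparison of reals.\<close>
    finally show ?thesis
      using PP.nonneg by (simp add: ennreal_less_iff)
  qed
  have "eventually (\<lambda>M. \<forall>a\<in>?Q. \<forall>b\<in>?Q. \<forall>p\<in>?S. \<forall>q\<in>?S.
      (\<forall>v. real M * \<bar>f (square_map G a p) v - f (square_map G b q) v\<bar> < 1) \<longrightarrow>
      ?d (square_map G a p) (square_map G b q) < R) sequentially"
  proof (rule eventually_ball_finite[OF finite_good_squares], rule ballI,
      rule eventually_ball_finite[OF finite_good_squares], rule ballI)
    fix a b assume ab: "a \<in> ?Q" "b \<in> ?Q"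
    then have "a \<in> arcs G \<times> arcs G" "b \<in> arcs G \<times> arcs G" by (auto simp: good_squares_def)
    then show "eventually (\<lambda>M. \<forall>p\<in>?S. \<forall>q\<in>?S.
      (\<forall>v. real M * \<bar>f (square_map G a p) v - f (square_map G b q) v\<bar> < 1) \<longrightarrow>
      ?d (square_map G a p) (square_map G b q) < R) sequentially"
      by (intro eventually_separated compact_Times compact_Icc coord ab fibre continuous_on_pdist_square_map)
  qed
  then obtain M where sep: "\<And>a b p q. a \<in> ?Q \<Longrightarrow> b \<in> ?Q \<Longrightarrow> p \<in> ?S \<Longrightarrow> q \<in> ?S \<Longrightarrow>
      (\<And>v. real M * \<bar>f (square_map G a p) v - f (square_map G b q) v\<bar> < 1) \<Longrightarrow>
      ?d (square_map G a p) (square_map G b q) < R"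
    unfolding eventually_sequentially by blast
  define L where "L = {\<kappa> :: 'k \<Rightarrow> int. even_label \<kappa> \<or> odd_label \<kappa>}"
  \<comment> \<open>At scale \<open>2 * M\<close>, two points with the same label have scaled
    coordinates less than 2 apart; halving gives the bound with \<open>M\<close> that
    \<open>sep\<close> asks for.\<close>
  define W where "W = (\<lambda>\<kappa>. {x \<in> Z. f x \<in> lattice_nbhd K (2 * M) \<kappa>})"
  have "eventually (\<lambda>n. \<forall>a\<in>?Q. \<forall>i<n. \<forall>j<n. \<exists>l\<in>L. square_map G a ` grid_square n i j \<subseteq> W l) sequentially"
  proof (rule eventually_ball_finite[OF finite_good_squares], rule ballI)
    fix a assume a: "a \<in> ?Q"
    let ?C = "(\<lambda>\<kappa>. {p \<in> ?S. f (square_map G a p) \<in> lattice_nbhd K (2 * M) \<kappa>}) ` L"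
    have "eventually (\<lambda>n. \<forall>i<n. \<forall>j<n. \<exists>B\<in>?C. grid_square n i j \<subseteq> B) sequentially"
      unfolding grid_square_def
    proof (rule eventually_grid_subordinate)
      fix B assume "B \<in> ?C"
      then show "openin (top_of_set ?S) B"
        using openin_continuous_map_preimage[OF cont[OF a] openin_lattice_nbhd[OF finK]] by auto
    next
      show "?S \<subseteq> \<Union>?C"
        using lattice_nbhd_cover[OF K in_K[OF a]] by (fastforce simp: L_def)
    qed
    then show "eventually (\<lambda>n. \<forall>i<n. \<forall>j<n. \<exists>l\<in>L. square_map G a ` grid_square n i j \<subseteq> W l) sequentially"
    proof eventually_elim
      case (elim n)
      show ?case
      proof (intro allI impI)
        fix i j assume "i < n" "j < n"
        then obtain \<kappa> where "\<kappa> \<in> L"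
          "grid_square n i j \<subseteq> {p \<in> ?S. f (square_map G a p) \<in> lattice_nbhd K (2 * M) \<kappa>}"
          using elim by blast
        then show "\<exists>l\<in>L. square_map G a ` grid_square n i j \<subseteq> W l"
          using a by (intro bexI[of _ \<kappa>]) (auto simp: W_def Z_def)
      qed
    qed
  qed
  then have "eventually (\<lambda>n. 0 < n \<and> (\<forall>a\<in>?Q. \<forall>i<n. \<forall>j<n. \<exists>l\<in>L. square_map G a ` grid_square n i j \<subseteq> W l)) sequentially"
    using eventually_gt_at_top[of "0::nat"] by eventually_elim blast
  then obtain n where n: "0 < n" "\<forall>a\<in>?Q. \<forall>i<n. \<forall>j<n. \<exists>l\<in>L. square_map G a ` grid_square n i j \<subseteq> W l"
    unfolding eventually_sequentially by blast
  have disj: "l = l'" if "l \<in> L" "l' \<in> L" "even_label l = even_label l'" "W l \<inter> W l' \<noteq> {}" for l l'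
    using that lattice_nbhd_disjoint[OF K] unfolding L_def W_def by blast
  have small: "?d x y < R" if xy: "x \<in> W l" "y \<in> W l" for l x y
  proof -
    obtain a b p q where ab: "a \<in> ?Q" "b \<in> ?Q" "p \<in> ?S" "q \<in> ?S"
      and [simp]: "x = square_map G a p" "y = square_map G b q"
      using xy unfolding W_def Z_def by blast
    have "real M * \<bar>f x v - f y v\<bar> < 1" for v
    proof -
      have "\<bar>real (2 * M) * f x v - of_int (l v)\<bar> < 1" "\<bar>real (2 * M) * f y v - of_int (l v)\<bar> < 1"
        using xy by (auto simp: W_def lattice_nbhd_def)
      then have "\<bar>real (2 * M) * f x v - real (2 * M) * f y v\<bar> < 2" by linarith
      then show ?thesis
        by (simp add: abs_mult flip: right_diff_distrib)
    qed
    then show ?thesis using sep[OF ab] by simp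
  qed
  show ?thesis
  proof (rule exI[of _ n], rule exI[of _ L], rule exI[of _ even_label], rule exI[of _ W], intro conjI)
    show "\<forall>l\<in>L. \<forall>l'\<in>L. even_label l = even_label l' \<longrightarrow> W l \<inter> W l' \<noteq> {} \<longrightarrow> l = l'"
      using disj by blast
    show "\<forall>l\<in>L. \<forall>x\<in>W l. \<forall>y\<in>W l. ?d x y < R"
      using small by blast
  qed (use n in blast)+
qed

end

section \<open>Subdivision\<close>

text \<open>The pair \<open>(e, k)\<close> is the \<open>k\<close>-th of \<open>n\<close> pieces of
  \<open>e\<close>. Its ends are points of the graph itself, so pieces of different edges are glued
  at the original vertices by \<open>edge_map\<close>.\<close>

definition sub_tail :: "('v, 'e) pre_digraph \<Rightarrow> nat \<Rightarrow> 'e \<times> nat \<Rightarrow> ('v, 'e) graph_point" where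
  "sub_tail G n f = edge_map G (fst f) (real (snd f) / real n)"

definition sub_head :: "('v, 'e) pre_digraph \<Rightarrow> nat \<Rightarrow> 'e \<times> nat \<Rightarrow> ('v, 'e) graph_point" where
  "sub_head G n f = edge_map G (fst f) (real (Suc (snd f)) / real n)"

lemma sum_telescope_bit: "(\<Sum>k<n. u k + u (Suc k)) = u 0 + (u n :: bit)"
proof (induction n)
  case 0
  show ?case by (cases "u 0") simp_all
next
  case (Suc n)
  have "(\<Sum>k<Suc n. u k + u (Suc k)) = u 0 + (u n + (u n + u (Suc n)))"
    by (simp add: Suc.IH add.assoc)
  then show ?case by (simp only: bit_add_self_left)
qed

text \<open>The subdivided chain is constant along each edge, so the contributions of its inner
  points telescope and only the original boundary remains.\<close>

lemma subdivided_closed_chain: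
  assumes G: "fin_digraph G" and c: "closed_chain G c" and n: "0 < n"
  shows "(\<Sum>f\<in>arcs G \<times> {..<n}. incidence (sub_tail G n) (sub_head G n) x f * c (fst f)) = 0"
proof -
  interpret fin_digraph G by (rule G)
  have inc: "(\<Sum>k<n. incidence (sub_tail G n) (sub_head G n) x (e, k)) =
      of_bool (Vertex (tail G e) = x) + of_bool (Vertex (head G e) = x)" for e
    using sum_telescope_bit[of "\<lambda>k. of_bool (edge_map G e (real k / real n) = x)" n] n
    by (simp add: incidence_def sub_tail_def sub_head_def del: of_nat_Suc)
  have "(\<Sum>f\<in>arcs G \<times> {..<n}. incidence (sub_tail G n) (sub_head G n) x f * c (fst f)) =
      (\<Sum>e\<in>arcs G. \<Sum>k<n. incidence (sub_tail G n) (sub_head G n) x (e, k) * c e)"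
    by (subst sum.cartesian_product) (simp add: case_prod_unfold)
  also have "\<dots> = (\<Sum>e\<in>arcs G. (of_bool (Vertex (tail G e) = x) + of_bool (Vertex (head G e) = x)) * c e)"
    by (simp only: inc flip: sum_distrib_right)
  also have "\<dots> = 0"
  proof (cases "\<exists>v\<in>verts G. x = Vertex v")
    case True
    then obtain v where "v \<in> verts G" "x = Vertex v" by blast
    then show ?thesis
      using c by (simp add: closed_chain_def boundary_def incidence_def)
  next
    case False
    then have "Vertex (tail G e) \<noteq> x" "Vertex (head G e) \<noteq> x" if "e \<in> arcs G" for e
      using that by auto
    then show ?thesis by simp
  qed
  finally show ?thesis .
qed

text \<open>The edge \<open>e0\<close> is cut between its tail and its first inner point.\<close>

definition lift_cut :: "('v, 'e) pre_digraph \<Rightarrow> 'e \<Rightarrow> ('v \<Rightarrow> bit) \<Rightarrow> ('v, 'e) graph_point \<Rightarrow> bit" where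
  "lift_cut G e0 h y = (case y of Vertex v \<Rightarrow> h v | Inner e t \<Rightarrow> h (tail G e) + of_bool (e = e0))"

lemma lift_cut_edge_map:
  assumes "h (tail G e) + h (head G e) = of_bool (e = e0)" and "t \<in> {0..1}"
  shows "lift_cut G e0 h (edge_map G e t) = h (tail G e) + of_bool (e = e0 \<and> t \<noteq> 0)"
proof -
  have "h (head G e) = h (tail G e) + of_bool (e = e0)"
    unfolding assms(1)[symmetric] by (simp only: bit_add_self_left)
  then show ?thesis
    by (auto simp: lift_cut_def edge_map_def)
qed

lemma subdivided_edge_in_unit:
  assumes "k < n"
  shows "real k / real n \<in> {0..1}" "real (Suc k) / real n \<in> {0..1}"
  using assms by auto

text \<open>Among the pieces of \<open>e0\<close> only the one with index 0 is cut, so the cochain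
  dual to \<open>e0\<close> becomes the one dual to \<open>(e0, 0)\<close>.\<close>

lemma lift_cut_subdivided:
  assumes h: "h (tail G e) + h (head G e) = of_bool (e = e0)" and k: "k < n"
  shows "lift_cut G e0 h (sub_tail G n (e, k)) + lift_cut G e0 h (sub_head G n (e, k)) = of_bool ((e, k) = (e0, 0))"
  using lift_cut_edge_map[OF h subdivided_edge_in_unit(1)[OF k]]
    lift_cut_edge_map[OF h subdivided_edge_in_unit(2)[OF k]] k
  by (cases "h (tail G e)"; cases "e = e0"; cases "k = 0") (auto simp: sub_tail_def sub_head_def)

lemma sub_ends_edge_map:
  assumes "k < n" "x = sub_tail G n (e, k) \<or> x = sub_head G n (e, k)"
  obtains t where "t \<in> {real k / real n..real (Suc k) / real n}" "t \<in> {0..1}" "x = edge_map G e t"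
proof -
  have "real k / real n \<le> real (Suc k) / real n" by (intro divide_right_mono) auto
  with that[of "real k / real n"] that[of "real (Suc k) / real n"] subdivided_edge_in_unit[OF assms(1)] assms(2)
  show ?thesis by (auto simp: sub_tail_def sub_head_def)
qed

section \<open>Localizable remainders of the square complex\<close>

text \<open>The bound \<open>few\<close> provides a nonzero cycle supported on good squares,
  \<open>R \<le> real m\<close> bounds the sets of the cover, and the girth bound is the one of
  \<open>ball_cut_function\<close> for the radius \<open>4 * (m + 3)\<close>.\<close>

lemma not_localizable:
  fixes G :: "('v, 'e) pre_digraph"
  assumes G: "fin_digraph G" and conn: "Digraph_Component.connected G"
    and S: "S \<subseteq> cells (square_complex G) 0"
    and few: "card (arcs G \<times> arcs G - good_squares G S) < (card (arcs G) - card (verts G))\<^sup>2"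
    and R: "R \<le> real m" and girth: "enat (2 * (4 * (m + 3)) + 1) < girth G"
  shows "\<not> localizable TYPE('k) 1 R (remove_0_cells (square_complex G) S)"
proof
  assume loc: "localizable TYPE('k) 1 R (remove_0_cells (square_complex G) S)"
  interpret fin_digraph G by (rule G)
  let ?d = "prod_dist (path_metric G) (path_metric G)"
  obtain n and L :: "('k \<Rightarrow> int) set" and ty :: "('k \<Rightarrow> int) \<Rightarrow> bool" and W where n: "0 < n"
    and disj: "\<forall>l\<in>L. \<forall>l'\<in>L. ty l = ty l' \<longrightarrow> W l \<inter> W l' \<noteq> {} \<longrightarrow> l = l'"
    and small: "\<forall>l\<in>L. \<forall>x\<in>W l. \<forall>y\<in>W l. ?d x y < R"
    and cover: "\<forall>a\<in>good_squares G S. \<forall>i<n. \<forall>j<n. \<exists>l\<in>L. square_map G a ` grid_square n i j \<subseteq> W l"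
    using localizable_grid_labelling[OF G conn S loc] by (elim exE conjE) (rule that; assumption)
  have "finite (arcs G \<times> arcs G - good_squares G S)" by simp
  from product_cycle_avoiding[OF G this few]
  obtain z :: "'e \<Rightarrow> 'e \<Rightarrow> bit" where z1: "\<forall>e'. closed_chain G (\<lambda>e. z e e')"
    and z2: "\<forall>e. closed_chain G (z e)"
    and zB: "\<forall>(e, e')\<in>arcs G \<times> arcs G - good_squares G S. z e e' = 0"
    and z_nonzero: "\<exists>e\<in>arcs G. \<exists>e'\<in>arcs G. z e e' \<noteq> 0"
    by (elim exE conjE) (rule that; assumption)
  from z_nonzero obtain e0 e0' where e0: "e0 \<in> arcs G" "e0' \<in> arcs G" "z e0 e0' \<noteq> 0"
    by blast
  define E where "E = arcs G \<times> {..<n}"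
  define V where "V = sub_tail G n ` E \<union> sub_head G n ` E"
  define zz where "zz = (\<lambda>(f :: 'e \<times> nat) (f' :: 'e \<times> nat). z (fst f) (fst f'))"
  \<comment> \<open>The choice is meaningful only where \<open>zz\<close> is nonzero, that is, over
    good squares. This is why \<open>labelled_cycle\<close> restricts only the labels of such
    squares.\<close>
  define lab where "lab = (\<lambda>f f'. SOME l. l \<in> L \<and>
      square_map G (fst f, fst f') ` grid_square n (snd f) (snd f') \<subseteq> W l)"
  have lab: "lab f f' \<in> L" "square_map G (fst f, fst f') ` grid_square n (snd f) (snd f') \<subseteq> W (lab f f')"
    if "f \<in> E" "f' \<in> E" "zz f f' \<noteq> 0" for f f'
  proof -
    have "(fst f, fst f') \<in> good_squares G S"
      using that bspec[OF zB, of "(fst f, fst f')"] by (intro ccontr[of "_ \<in> _"]) (auto simp: E_def zz_def)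
    then have "\<exists>l. l \<in> L \<and> square_map G (fst f, fst f') ` grid_square n (snd f) (snd f') \<subseteq> W l"
      using cover[rule_format, of "(fst f, fst f')" "snd f" "snd f'"] that by (auto simp: E_def)
    from someI_ex[OF this] show "lab f f' \<in> L"
        "square_map G (fst f, fst f') ` grid_square n (snd f) (snd f') \<subseteq> W (lab f f')"
      unfolding lab_def by blast+
  qed
  have corner: "(x, y) \<in> W (lab f f')"
    if f: "f \<in> E" "f' \<in> E" "zz f f' \<noteq> 0" and x: "x = sub_tail G n f \<or> x = sub_head G n f"
      and y: "y = sub_tail G n f' \<or> y = sub_head G n f'" for f f' x y
  proof -
    have k: "snd f < n" "snd f' < n" using f by (auto simp: E_def)
    obtain s where s: "s \<in> {real (snd f) / real n..real (Suc (snd f)) / real n}" "x = edge_map G (fst f) s"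
      using sub_ends_edge_map[OF k(1), of x G "fst f"] x by auto
    obtain t where t: "t \<in> {real (snd f') / real n..real (Suc (snd f')) / real n}" "y = edge_map G (fst f') t"
      using sub_ends_edge_map[OF k(2), of y G "fst f'"] y by auto
    have "(x, y) \<in> square_map G (fst f, fst f') ` grid_square n (snd f) (snd f')"
      using s t by (intro image_eqI[of _ _ "(s, t)"]) (auto simp: square_map_def grid_square_def)
    then show ?thesis using lab(2)[OF f] by blast
  qed
  interpret labelled_cycle V E "sub_tail G n" "sub_head G n" zz lab ty
  proof
    show "finite V" "finite E" by (simp_all add: V_def E_def)
    show "sub_tail G n f \<in> V" "sub_head G n f \<in> V" if "f \<in> E" for f
      using that by (auto simp: V_def)
    show "(\<Sum>f\<in>E. incidence (sub_tail G n) (sub_head G n) x f * zz f f') = 0" for x f'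
      unfolding E_def zz_def by (rule subdivided_closed_chain[OF G z1[rule_format] n])
    show "(\<Sum>f'\<in>E. incidence (sub_tail G n) (sub_head G n) y f' * zz f f') = 0" for y f
      unfolding E_def zz_def by (rule subdivided_closed_chain[OF G z2[rule_format] n])
    show "lab e e' = lab f f'"
      if "e \<in> E" "e' \<in> E" "f \<in> E" "f' \<in> E" "zz e e' \<noteq> 0" "zz f f' \<noteq> 0"
        "x = sub_tail G n e \<or> x = sub_head G n e" "x = sub_tail G n f \<or> x = sub_head G n f"
        "y = sub_tail G n e' \<or> y = sub_head G n e'" "y = sub_tail G n f' \<or> y = sub_head G n f'"
        "ty (lab e e') = ty (lab f f')" for e e' f f' x y
    proof (rule disj[rule_format])
      show "W (lab e e') \<inter> W (lab f f') \<noteq> {}"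
        using corner[of e e' x y] corner[of f f' x y] that by blast
    qed (use that lab(1) in auto)
  qed
  \<comment> \<open>A representative grid square for each label. The tails of its two edges serve as
    the centres of balls containing the two projections of the part with that label.\<close>
  define base where "base = (\<lambda>l. SOME p. fst p \<in> E \<and> snd p \<in> E \<and> zz (fst p) (snd p) \<noteq> 0 \<and> lab (fst p) (snd p) = l)"
  define r where "r = (\<lambda>l. tail G (fst (fst (base l))))"
  define r' where "r' = (\<lambda>l. tail G (fst (snd (base l))))"
  have near: "tail G (fst f) \<in> graph_ball G (r (lab f f')) (m + 3)" "head G (fst f) \<in> graph_ball G (r (lab f f')) (m + 3)"
    "tail G (fst f') \<in> graph_ball G (r' (lab f f')) (m + 3)" "head G (fst f') \<in> graph_ball G (r' (lab f f')) (m + 3)"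
    if f: "f \<in> E" "f' \<in> E" "zz f f' \<noteq> 0" for f f'
  proof -
    define b b' where "b = fst (base (lab f f'))" and "b' = snd (base (lab f f'))"
    have "\<exists>p. fst p \<in> E \<and> snd p \<in> E \<and> zz (fst p) (snd p) \<noteq> 0 \<and> lab (fst p) (snd p) = lab f f'"
      using f by (intro exI[of _ "(f, f')"]) simp
    from someI_ex[OF this] have b: "b \<in> E" "b' \<in> E" "zz b b' \<noteq> 0" "lab b b' = lab f f'"
      unfolding b_def b'_def base_def by blast+
    have "(sub_tail G n b, sub_tail G n b') \<in> W (lab f f')"
      using corner[OF b(1-3)] b(4) by simp
    moreover have "(sub_tail G n f, sub_tail G n f') \<in> W (lab f f')"
      using corner[OF f] by simp
    ultimately have "?d (sub_tail G n b, sub_tail G n b') (sub_tail G n f, sub_tail G n f') < real m"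
      using small[rule_format, OF lab(1)[OF f]] R by fastforce
    then have "sqrt ((path_metric G (sub_tail G n b) (sub_tail G n f))\<^sup>2 +
        (path_metric G (sub_tail G n b') (sub_tail G n f'))\<^sup>2) < real m"
      by (simp add: prod_dist_def)
    then have less: "path_metric G (sub_tail G n b) (sub_tail G n f) < real m"
        "path_metric G (sub_tail G n b') (sub_tail G n f') < real m"
      by (rule order_le_less_trans[OF real_sqrt_sum_squares_ge1],
          rule order_le_less_trans[OF real_sqrt_sum_squares_ge2])
    have mem: "fst q \<in> arcs G" "real (snd q) / real n \<in> {0..1}" if "q \<in> E" for q
      using that subdivided_edge_in_unit(1)[of "snd q" n] by (auto simp: E_def)
    note ball1 = graph_ball_if_path_metric_less[OF G conn mem[OF b(1)] mem[OF f(1)] less(1)[unfolded sub_tail_def]]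
    note ball2 = graph_ball_if_path_metric_less[OF G conn mem[OF b(2)] mem[OF f(2)] less(2)[unfolded sub_tail_def]]
    have mono: "graph_ball G x (m + 2) \<subseteq> graph_ball G x (m + 3)" for x
      by (rule graph_ball_mono) simp
    show "tail G (fst f) \<in> graph_ball G (r (lab f f')) (m + 3)" "head G (fst f) \<in> graph_ball G (r (lab f f')) (m + 3)"
        "tail G (fst f') \<in> graph_ball G (r' (lab f f')) (m + 3)" "head G (fst f') \<in> graph_ball G (r' (lab f f')) (m + 3)"
      using ball1 ball2 mono unfolding r_def r'_def b_def b'_def by blast+
  qed
  \<comment> \<open>The ball of radius \<open>m + 3\<close> around the centre of one label must lie
    in the domain of the potential of a neighbouring label. The centres are at most
    \<open>(m + 3) + 3 + (m + 3)\<close> apart; a further \<open>m + 3\<close> keeps the total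
    within \<open>4 * (m + 3)\<close>.\<close>
  let ?\<rho> = "4 * (m + 3)"
  have cut_ex: "\<forall>x. \<exists>h. \<forall>e\<in>arcs G. tail G e \<in> graph_ball G x ?\<rho> \<longrightarrow> head G e \<in> graph_ball G x ?\<rho> \<longrightarrow>
      h (tail G e) + h (head G e) = (of_bool (e = f) :: bit)" if "f \<in> arcs G" for f
    using ball_cut_function[OF G girth that] by blast
  obtain cut where cut: "\<And>x e. e \<in> arcs G \<Longrightarrow> tail G e \<in> graph_ball G x ?\<rho> \<Longrightarrow> head G e \<in> graph_ball G x ?\<rho> \<Longrightarrow>
      cut x (tail G e) + cut x (head G e) = (of_bool (e = e0) :: bit)"
    using cut_ex[OF e0(1)] by metis
  obtain cut' where cut': "\<And>x e. e \<in> arcs G \<Longrightarrow> tail G e \<in> graph_ball G x ?\<rho> \<Longrightarrow> head G e \<in> graph_ball G x ?\<rho> \<Longrightarrow>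
      cut' x (tail G e) + cut' x (head G e) = (of_bool (e = e0') :: bit)"
    using cut_ex[OF e0(2)] by metis
  have big: "x \<in> graph_ball G y (m + 3) \<Longrightarrow> x \<in> graph_ball G y ?\<rho>" for x y
    using graph_ball_mono[of "m + 3" ?\<rho> G y] by auto
  define h where "h = (\<lambda>l. lift_cut G e0 (cut (r l)))"
  define k where "k = (\<lambda>l. lift_cut G e0' (cut' (r' l)))"
  \<comment> \<open>The difference of the two potentials will be constant on the ball around
    \<open>r j\<close>; \<open>c i j\<close> reads it off at the centre.\<close>
  define c where "c = (\<lambda>i j. cut (r i) (r j) + cut (r j) (r j))"
  have "zz (e0, 0) (e0', 0) = 0"
  proof (rule cycle_vanishes[where h = h and k = k and c = c])
    show "(e0, 0) \<in> E" "(e0', 0) \<in> E" using e0 n by (auto simp: E_def)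
  next
    fix f f' assume f: "f \<in> E" "f' \<in> E" "zz f f' \<noteq> 0"
    have ff: "fst f \<in> arcs G" "snd f < n" "fst f' \<in> arcs G" "snd f' < n" using f by (auto simp: E_def)
    show "h (lab f f') (sub_tail G n f) + h (lab f f') (sub_head G n f) = of_bool (f = (e0, 0))"
      using lift_cut_subdivided[OF cut[OF ff(1) big[OF near(1)[OF f]] big[OF near(2)[OF f]]] ff(2)]
      by (simp add: h_def)
    show "k (lab f f') (sub_tail G n f') + k (lab f f') (sub_head G n f') = of_bool (f' = (e0', 0))"
      using lift_cut_subdivided[OF cut'[OF ff(3) big[OF near(3)[OF f]] big[OF near(4)[OF f]]] ff(4)]
      by (simp add: k_def)
  next
    fix e f e' x
    assume ef: "e \<in> E" "f \<in> E" "e' \<in> E" "zz e e' \<noteq> 0" "zz f e' \<noteq> 0"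
      and x: "x = sub_tail G n e \<or> x = sub_head G n e" "x = sub_tail G n f \<or> x = sub_head G n f"
    let ?i = "lab e e'" and ?j = "lab f e'"
    have arcs: "fst e \<in> arcs G" "fst f \<in> arcs G" and kk: "snd e < n" "snd f < n"
      using ef by (auto simp: E_def)
    obtain s where s: "s \<in> {0..1}" "x = edge_map G (fst e) s"
      using sub_ends_edge_map[OF kk(1), of x G "fst e"] x by auto
    obtain t where t: "t \<in> {0..1}" "x = edge_map G (fst f) t"
      using sub_ends_edge_map[OF kk(2), of x G "fst f"] x by auto
    note near_e = near[OF ef(1,3,4)] and near_f = near[OF ef(2,3,5)]
    \<comment> \<open>The edges share the point \<open>x\<close>, so the distance is 0, which is
      below 1; the ball lemma with \<open>n = 1\<close> then yields the radius 3.\<close>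
    have "path_metric G (edge_map G (fst e) s) (edge_map G (fst f) t) < real 1"
      using path_metric_self[OF G conn edge_map_in_graph_points[OF arcs(2) t(1)]] s t by simp
    from graph_ball_if_path_metric_less(1)[OF G conn arcs(1) s(1) arcs(2) t(1) this]
    have "tail G (fst f) \<in> graph_ball G (tail G (fst e)) 3" by (simp add: numeral_eq_Suc)
    then have rj: "r ?j \<in> graph_ball G (r ?i) ((m + 3) + 3 + (m + 3))"
      by (intro graph_ball_trans[OF graph_ball_trans[OF near_e(1)] graph_ball_sym[OF near_f(1)]])
    have sub: "y \<in> graph_ball G (r ?i) ?\<rho>" if "y \<in> graph_ball G (r ?j) (m + 3)" for y
      using graph_ball_trans[OF rj that] graph_ball_mono[of "(m + 3) + 3 + (m + 3) + (m + 3)" ?\<rho> G "r ?i"] by auto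
    \<comment> \<open>On this ball both potentials have the cochain dual to \<open>e0\<close> as
      coboundary, so their sum modulo 2 has coboundary zero.\<close>
    have const: "cut (r ?i) y + cut (r ?j) y = c ?i ?j" if "y \<in> graph_ball G (r ?j) (m + 3)" for y
      unfolding c_def
    proof (rule constant_on_ball[OF _ that, where g = "\<lambda>y. cut (r ?i) y + cut (r ?j) y"])
      fix a assume a: "a \<in> arcs G" "tail G a \<in> graph_ball G (r ?j) (m + 3)" "head G a \<in> graph_ball G (r ?j) (m + 3)"
      have "cut (r ?i) (tail G a) + cut (r ?i) (head G a) = cut (r ?j) (tail G a) + cut (r ?j) (head G a)"
        using cut[OF a(1) sub[OF a(2)] sub[OF a(3)]] cut[OF a(1) big[OF a(2)] big[OF a(3)]] by simp
      then show "cut (r ?i) (tail G a) + cut (r ?j) (tail G a) = cut (r ?i) (head G a) + cut (r ?j) (head G a)"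
        by (cases "cut (r ?i) (tail G a)"; cases "cut (r ?i) (head G a)";
            cases "cut (r ?j) (tail G a)"; cases "cut (r ?j) (head G a)") simp_all
    qed
    \<comment> \<open>For both labels \<open>x\<close> is written as a point of
      \<open>fst f\<close>, although it also lies on \<open>fst e\<close>. The correction on
      \<open>e0\<close> is then the same in both expressions and cancels.\<close>
    have "h ?i x = cut (r ?i) (tail G (fst f)) + of_bool (fst f = e0 \<and> t \<noteq> 0)"
      unfolding h_def t(2)
      by (rule lift_cut_edge_map[OF cut[OF arcs(2) sub[OF near_f(1)] sub[OF near_f(2)]] t(1)])
    moreover have "h ?j x = cut (r ?j) (tail G (fst f)) + of_bool (fst f = e0 \<and> t \<noteq> 0)"
      unfolding h_def t(2)
      by (rule lift_cut_edge_map[OF cut[OF arcs(2) big[OF near_f(1)] big[OF near_f(2)]] t(1)])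
    ultimately have "h ?i x + h ?j x = cut (r ?i) (tail G (fst f)) + cut (r ?j) (tail G (fst f))"
      by (cases "fst f = e0 \<and> t \<noteq> 0"; cases "cut (r ?i) (tail G (fst f))"; cases "cut (r ?j) (tail G (fst f))") simp_all
    then show "h ?i x + h ?j x = c ?i ?j"
      using const[OF near_f(1)] by simp
  qed
  with e0(3) show False by (simp add: zz_def)
qed

theorem mainTheorem2:
  fixes d :: nat and I :: "nat set" and G :: "nat \<Rightarrow> ('v, 'e) pre_digraph"
  assumes "d \<ge> 3"
    and "infinite I"
    and "\<And>N. N \<in> I \<Longrightarrow> fin_digraph (G N)"
    and "\<And>N. N \<in> I \<Longrightarrow> Digraph_Component.connected (G N)"
    and "\<And>N. N \<in> I \<Longrightarrow> regular_graph d (G N)"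
    and "\<And>N. N \<in> I \<Longrightarrow> card (verts (G N)) = N"
    and "((\<lambda>N. girth (G N)) \<longlongrightarrow> \<infinity>) (inf at_top (principal I))"
  shows "\<not> hyperfinite TYPE('k) 1 I
            (\<lambda>N. product_complex (graph_complex (G N)) (graph_complex (G N)))"
proof
  assume hyp: "hyperfinite TYPE('k) 1 I (\<lambda>N. square_complex (G N))"
  \<comment> \<open>At most \<open>d\<^sup>2\<close> squares are lost per removed vertex, so this
    fraction loses at most \<open>N\<^sup>2 / 8\<close> squares, half of the lower bound
    \<open>N\<^sup>2 / 4\<close> for the number of independent product cycles.\<close>
  define \<epsilon> where "\<epsilon> = 1 / (8 * (real d)\<^sup>2)"
  have "0 < \<epsilon>" using assms(1) by (simp add: \<epsilon>_def)
  then obtain R where R: "\<And>N. N \<in> I \<Longrightarrow> \<exists>S. finite S \<and> S \<subseteq> cells (square_complex (G N)) 0 \<and>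
      real (card S) \<le> \<epsilon> * real (card (cells (square_complex (G N)) 0)) \<and>
      localizable TYPE('k) 1 R (remove_0_cells (square_complex (G N)) S)"
    using hyp unfolding hyperfinite_def by meson
  \<comment> \<open>The range \<open>R\<close> is fixed before the member of the family, so the
    girth of a later \<open>G N\<close> may be required to exceed any bound depending on
    \<open>R\<close>.\<close>
  obtain m where m: "R \<le> real m" using real_arch_simple by blast
  have "eventually (\<lambda>N. enat (2 * (4 * (m + 3)) + 1) < girth (G N)) (inf at_top (principal I))"
    by (rule order_tendstoD(1)[OF assms(7)]) simp
  then obtain N0 where N0: "\<And>N. N \<ge> N0 \<Longrightarrow> N \<in> I \<Longrightarrow> enat (2 * (4 * (m + 3)) + 1) < girth (G N)"
    unfolding eventually_inf_principal eventually_at_top_linorder by blast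
  \<comment> \<open>The 1 in the maximum makes \<open>N\<close> positive, which the strict
    inequality between the two counts requires.\<close>
  obtain N where N: "N \<ge> max 1 N0" "N \<in> I"
    using assms(2) unfolding infinite_nat_iff_unbounded_le by blast
  obtain S where S: "finite S" "S \<subseteq> cells (square_complex (G N)) 0"
    "real (card S) \<le> \<epsilon> * real (card (cells (square_complex (G N)) 0))"
    "localizable TYPE('k) 1 R (remove_0_cells (square_complex (G N)) S)"
    using R[OF N(2)] by blast
  note GN = assms(3)[OF N(2)] and reg = assms(5)[OF N(2)] and cardV = assms(6)[OF N(2)]
  let ?a = "card (arcs (G N))" and ?bad = "card (arcs (G N) \<times> arcs (G N) - good_squares (G N) S)"
  have "real ?bad \<le> real (card S) * (real d)\<^sup>2"
    using card_bad_squares[OF GN reg S(1,2)] by (simp flip: of_nat_power of_nat_mult)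
  also have "\<dots> \<le> \<epsilon> * (real N)\<^sup>2 * (real d)\<^sup>2"
    using S(3) by (intro mult_right_mono) (simp_all add: card_cells_square_complex_0 cardV)
  also have "\<dots> = (real N)\<^sup>2 / 8"
    using assms(1) by (simp add: \<epsilon>_def field_simps)
  finally have bad: "8 * real ?bad \<le> (real N)\<^sup>2" by simp
  have "3 * N \<le> 2 * ?a"
    using regular_graph_handshake[OF GN reg] assms(1) by (simp add: cardV)
  \<comment> \<open>From \<open>d \<ge> 3\<close> there are at least \<open>3 * N / 2\<close> edges,
    so the subtraction of naturals is exact and the cycle rank is at least
    \<open>N / 2\<close>.\<close>
  then have "N \<le> 2 * (?a - N)" by linarith
  then have "N\<^sup>2 \<le> (2 * (?a - N))\<^sup>2" by (rule power_mono) simp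
  then have "N\<^sup>2 \<le> 4 * (?a - N)\<^sup>2" by (simp add: power2_eq_square)
  moreover have "real (8 * ?bad) \<le> real (N\<^sup>2)"
    using bad by simp
  then have "8 * ?bad \<le> N\<^sup>2"
    by (simp only: of_nat_le_iff)
  moreover have "0 < N\<^sup>2" using N(1) by simp
  ultimately have "?bad < (?a - card (verts (G N)))\<^sup>2"
    unfolding cardV by linarith
  moreover have "N0 \<le> N" using N(1) by simp
  ultimately show False
    using not_localizable[OF GN assms(4)[OF N(2)] S(2) _ m N0[OF _ N(2)], where 'k = 'k] S(4) by blast
qed

end
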